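(* Let $n\ge1$, let $\mu$ be the uniform probability measure on $\{\pm1\}^n$, let $J$ be a real symmetric positive definite $n\times n$ matrix, let $h\in\mathbb{R}^n$, and let $\nu_0$ be the probability measure on $\{\pm1\}^n$ with $$\frac{d\nu_0}{d\mu}(x)=\frac1Z\exp\left(\tfrac12\langle x,Jx\rangle+\langle h,x\rangle\right),$$ where $Z$ is the normalizing constant. Let $\varphi:\{\pm1\}^n\to\mathbb{R}$. Then there exists a probability measure $m$ on $\mathbb{R}^n\times\mathbb{R}^n$ such that $$\nu_0(A)=\int w_{u,v}(A)\,dm(u,v)\qquad\text{for all }A\subset\{\pm1\}^n,$$ with the following properties: 1. for $m$-almost every $(u,v)$, $\int\varphi\,dw_{u,v}=\int\varphi\,d\nu_0$; 2. for $m$-almost every $(u,v)$, $|u|^2\le\|J\|_{OP}$; 3. for all $x\sim y$ in $\{\pm1\}^n$, $$\int\frac{w_{u,v}(x)\,w_{u,v}(y)}{w_{u,v}(x)+w_{u,v}(y)}\,dm(u,v)\le\frac{\nu_0(x)\,\nu_0(y)}{\nu_0(x)+\nu_0(y)}.$$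
   Context: For $u,v\in\mathbb{R}^n$, $w_{u,v}$ is the probability measure on $\{\pm1\}^n$ defined by $$\frac{dw_{u,v}}{d\mu}(x)=\frac1{Z_{u,v}}\exp\left(\tfrac12\langle u,x\rangle^2+\langle v,x\rangle\right),\qquad Z_{u,v}=\int_{\{\pm1\}^n}e^{\frac12\langle u,x\rangle^2+\langle v,x\rangle}\,d\mu(x).$$ $|\cdot|$ is the Euclidean norm, $\|J\|_{OP}$ the operator norm, and $x\sim y$ means that $x$ and $y$ differ in exactly one coordinate. For a measure $w$ on $\{\pm1\}^n$, $w(x)$ denotes $w(\{x\})$. *)

theory Defs
  imports "HOL-Probability.Probability"
begin

definition cube :: "(real ^ 'n) set" where
  "cube = {x. \<forall>i. x $ i = 1 \<or> x $ i = -1}"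

text \<open>The measures below live on the space \<^term>\<open>cube\<close> with its full power set as
  sigma-algebra, although their points have type \<^typ>\<open>real ^ 'n\<close>.\<close>

definition cube_unif :: "(real ^ 'n) measure" where
  "cube_unif = uniform_count_measure cube"

definition gibbs :: "(real ^ 'n \<Rightarrow> real) \<Rightarrow> (real ^ 'n) measure" where
  "gibbs H = density cube_unif
     (\<lambda>x. ennreal (exp (H x) / (\<integral>y. exp (H y) \<partial>cube_unif)))"

definition ising_measure :: "real ^ 'n ^ 'n \<Rightarrow> real ^ 'n \<Rightarrow> (real ^ 'n) measure" where
  "ising_measure J h = gibbs (\<lambda>x. 1/2 * (x \<bullet> (J *v x)) + h \<bullet> x)"

definition rank_one_measure :: "real ^ 'n \<Rightarrow> real ^ 'n \<Rightarrow> (real ^ 'n) measure" where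
  "rank_one_measure u v = gibbs (\<lambda>x. 1/2 * (u \<bullet> x)\<^sup>2 + v \<bullet> x)"

definition sym_pos_def :: "real ^ 'n ^ 'n \<Rightarrow> bool" where
  "sym_pos_def J \<longleftrightarrow> transpose J = J \<and> (\<forall>x. x \<noteq> 0 \<longrightarrow> x \<bullet> (J *v x) > 0)"

definition neighbours :: "real ^ 'n \<Rightarrow> real ^ 'n \<Rightarrow> bool" where
  "neighbours x y \<longleftrightarrow> card {i. x $ i \<noteq> y $ i} = 1"

end

theory Submission
  imports Defs "HOL-Real_Asymp.Real_Asymp"
begin

text \<open>Among the measures \<open>w\<close> with quadratic part \<open>\<langle>x, Ax\<rangle>/2\<close>, \<open>0 \<le> A \<le> J\<close>, and linear part \<open>v\<close>, passing
  from \<open>(A, v)\<close> to \<open>(A - t\<^sup>2 uu\<^sup>T, v + tu + t\<^sup>2 au)\<close>, where \<open>a\<close> is the mean of \<open>\<langle>u, x\<rangle>\<close>, multiplies each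
  weight by \<open>1 + t(\<langle>u, x\<rangle> - a) + o(t\<^sup>2)\<close>: this is one step of stochastic localization, without the
  randomness. Along such steps the weights are linear and the functionals \<open>w(x)w(y)/(w(x) + w(y))\<close> concave up to
  \<open>o(t\<^sup>2)\<close>. So is \<open>(\<integral>\<phi> dw - c)\<^sup>2\<close>, provided \<open>\<langle>u, x\<rangle>\<close> is uncorrelated with \<open>\<phi>\<close>, and such a \<open>u \<noteq> 0\<close> exists in
  the range of \<open>A\<close> as soon as its rank is at least two. The coercive function
  \<open>L = (1 + |v|\<^sup>2) exp((n + 3) tr A)\<close> has a strictly negative second difference along a step. Hence a minimiser of any combination of
  these functionals with nonnegative coefficients (arbitrary ones for the weights, a positive one for \<open>L\<close>)
  has rank at most one, since one of the two steps \<open>\<plusminus>t\<close> would otherwise decrease it.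

  By convex duality this suffices. Dividing the constraint functions by \<open>L\<close> makes them vanish as \<open>v\<close> tends to
  infinity, so that their range becomes compact after adding \<open>0\<close>; were there no mixing measure,
  a separating hyperplane would give a combination that is larger at every rank-one parameter than at \<open>(J, h)\<close>. The mixture
  found in this way is finitely supported, and \<open>\<integral>\<phi> dw\<close> is exactly constant on it because the
  constraint \<open>(\<integral>\<phi> dw - c)\<^sup>2 \<le> 0\<close> holds in mean.\<close>

section \<open>A moment problem with a coercive weight\<close>

text \<open>Separation of a point from a closed convex set. Constraints in \<open>E\<close> must
  hold with equality; the others only need a mean \<open>\<le> 0\<close>, which is why their
  multipliers are nonnegative. Since \<open>0\<close> belongs to the compact hull, the separating
  level \<open>b\<close> is negative, and \<open>-b\<close> becomes the multiplier
  \<open>\<beta> > 0\<close> of \<open>\<Lambda>\<close>.\<close>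

lemma finite_moment_alternative:
  fixes \<Theta> :: "'p::euclidean_space set" and f :: "'p \<Rightarrow> real^'k" and \<Lambda> :: "'p \<Rightarrow> real"
  assumes "closed \<Theta>" and contf: "continuous_on \<Theta> f" and cont\<Lambda>: "continuous_on \<Theta> \<Lambda>"
    and \<Lambda>1: "\<And>\<theta>. \<theta> \<in> \<Theta> \<Longrightarrow> \<Lambda> \<theta> \<ge> 1"
    and bd: "\<And>\<theta>. \<theta> \<in> \<Theta> \<Longrightarrow> norm (f \<theta>) \<le> B"
    and coercive: "\<And>R. bounded {\<theta> \<in> \<Theta>. \<Lambda> \<theta> \<le> R}"
    and "L0 > 0"
    and dual: "\<And>a0 a \<beta>. \<lbrakk>\<And>k. k \<notin> E \<Longrightarrow> a $ k \<ge> 0; \<beta> > 0; a0 + \<beta> * L0 < 0\<rbrakk>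
        \<Longrightarrow> \<exists>\<theta>\<in>\<Theta>. a0 + a \<bullet> f \<theta> + \<beta> * \<Lambda> \<theta> \<le> 0"
  shows "\<exists>T q. finite T \<and> T \<subseteq> \<Theta> \<and> (\<forall>\<theta>\<in>T. 0 \<le> q \<theta>) \<and> (\<Sum>\<theta>\<in>T. q \<theta>) = (1::real)
      \<and> (\<forall>k\<in>E. (\<Sum>\<theta>\<in>T. q \<theta> * f \<theta> $ k) = 0) \<and> (\<forall>k. (\<Sum>\<theta>\<in>T. q \<theta> * f \<theta> $ k) \<le> 0)"
proof -
  define g where "g \<theta> = (1 / \<Lambda> \<theta>) *\<^sub>R (1::real, f \<theta>)" for \<theta>
  \<comment> \<open>The slack cone: if a point of \<open>C + P\<close> has second component
    \<open>0\<close>, the second component of its part in \<open>C\<close> is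
    \<open>\<le> 0\<close>, and vanishes on \<open>E\<close>.\<close>
  define P where "P = {(0::real)} \<times> {y::real^'k. \<forall>k. (k \<in> E \<longrightarrow> y $ k = 0) \<and> y $ k \<ge> 0}"
  define C where "C = convex hull (insert 0 (g ` \<Theta>))"
  have \<Lambda>pos: "\<Lambda> \<theta> > 0" if "\<theta> \<in> \<Theta>" for \<theta> using \<Lambda>1[OF that] by simp
  have contg: "continuous_on \<Theta> g"
    unfolding g_def using \<Lambda>pos by (intro continuous_intros contf cont\<Lambda>) (auto simp: less_imp_neq[symmetric] dest: \<Lambda>pos)
  have normg: "norm (g \<theta>) \<le> (1 + \<bar>B\<bar>) / \<Lambda> \<theta>" if "\<theta> \<in> \<Theta>" for \<theta>
  proof -
    have "norm (1::real, f \<theta>) \<le> 1 + \<bar>B\<bar>"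
      using norm_Pair_le[of "1::real" "f \<theta>"] bd[OF that] by simp
    then show ?thesis
      unfolding g_def norm_scaleR using \<Lambda>pos[OF that] by (simp add: divide_simps)
  qed
  have "bounded (insert 0 (g ` \<Theta>))"
  proof (rule boundedI[of _ "1 + \<bar>B\<bar>"])
    fix y assume "y \<in> insert 0 (g ` \<Theta>)"
    then show "norm y \<le> 1 + \<bar>B\<bar>"
    proof
      assume "y \<in> g ` \<Theta>"
      then obtain \<theta> where th: "\<theta> \<in> \<Theta>" "y = g \<theta>" by auto
      have "(1 + \<bar>B\<bar>) / \<Lambda> \<theta> \<le> 1 + \<bar>B\<bar>"
        using \<Lambda>1[OF th(1)] by (simp add: divide_simps mult_le_cancel_left1)
      with normg[OF th(1)] th show ?thesis by simp
    qed simp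
  qed
  moreover have "closed (insert 0 (g ` \<Theta>))"
    unfolding closed_sequential_limits
  proof (intro allI impI, elim conjE)
    fix y l assume y: "\<forall>n. y n \<in> insert 0 (g ` \<Theta>)" and l: "y \<longlonglongrightarrow> l"
    show "l \<in> insert 0 (g ` \<Theta>)"
    proof (cases "l = 0")
      case False
      \<comment> \<open>As \<open>norm (g \<theta>)\<close> is at most a constant over
        \<open>\<Lambda> \<theta>\<close>, a sequence with a nonzero limit eventually comes from a
        sublevel set of \<open>\<Lambda>\<close>, which is compact by coercivity.\<close>
      define K where "K = {\<theta> \<in> \<Theta>. \<Lambda> \<theta> \<le> 2 * (1 + \<bar>B\<bar>) / norm l}"
      have "closed K"
        unfolding K_def using continuous_closed_preimage[OF cont\<Lambda> \<open>closed \<Theta>\<close>, of "{..2 * (1 + \<bar>B\<bar>) / norm l}"]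
        by (simp add: vimage_def Int_def)
      then have "compact K" using coercive unfolding K_def by (simp add: compact_eq_bounded_closed)
      then have cl: "closed (g ` K)"
        by (intro compact_imp_closed compact_continuous_image continuous_on_subset[OF contg]) (auto simp: K_def)
      have "(\<lambda>n. norm (y n)) \<longlonglongrightarrow> norm l" using l by (rule tendsto_norm)
      then have "eventually (\<lambda>n. norm (y n) > norm l / 2) sequentially"
        by (rule order_tendstoD) (use False in simp)
      then have "eventually (\<lambda>n. y n \<in> g ` K) sequentially"
      proof eventually_elim
        case (elim n)
        then have "y n \<noteq> 0" by auto
        then obtain \<theta> where th: "\<theta> \<in> \<Theta>" "y n = g \<theta>" using y by blast
        have "norm l / 2 < (1 + \<bar>B\<bar>) / \<Lambda> \<theta>" using elim normg[OF th(1)] unfolding th(2) by linarith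
        then have "\<theta> \<in> K" using th False \<Lambda>pos[OF th(1)] by (simp add: K_def field_simps)
        with th show ?case by auto
      qed
      then have "l \<in> g ` K"
        using Lim_in_closed_set[OF cl _ _ l] by simp
      then show ?thesis by (auto simp: K_def)
    qed simp
  qed
  ultimately have "compact C"
    unfolding C_def by (intro compact_convex_hull) (simp add: compact_eq_bounded_closed)
  have "closed {y::real^'k. \<forall>k. (k \<in> E \<longrightarrow> y $ k = 0) \<and> y $ k \<ge> 0}"
    by (intro closed_Collect_all closed_Collect_conj closed_Collect_imp closed_Collect_eq
        closed_Collect_le open_Collect_const continuous_intros)
  then have "closed P" unfolding P_def by (intro closed_Times) auto
  then have closed: "closed (\<Union>x\<in>C. \<Union>y\<in>P. {x + y})"
    by (intro compact_closed_sums \<open>compact C\<close>)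
  have "convex P" unfolding P_def
    by (intro convex_Times) (auto simp: convex_def)
  then have convex: "convex (\<Union>x\<in>C. \<Union>y\<in>P. {x + y})"
    by (intro convex_sums) (simp_all add: C_def)
  \<comment> \<open>Up to scaling by \<open>L0\<close>, this membership is the mixture sought: the
    first coordinate fixes the total mass.\<close>
  have "(1 / L0, 0) \<in> (\<Union>x\<in>C. \<Union>y\<in>P. {x + y})"
  proof (rule ccontr)
    assume "\<not> ?thesis"
    from separating_hyperplane_closed_point[OF convex closed this]
    obtain aa b where aa: "aa \<bullet> (1 / L0, 0) < b" "\<And>x y. x \<in> C \<Longrightarrow> y \<in> P \<Longrightarrow> b < aa \<bullet> (x + y)"
      by fast
    obtain a0 a where a: "aa = (a0, a)" by (cases aa)
    have P0: "0 \<in> P" by (auto simp: P_def zero_prod_def)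
    have C0: "0 \<in> C" unfolding C_def by (intro hull_inc) simp
    have "b < 0" using aa(2)[OF C0 P0] by simp
    have "a $ k \<ge> 0" if "k \<notin> E" for k
    proof (rule ccontr)
      assume "\<not> a $ k \<ge> 0"
      \<comment> \<open>This slack vector is chosen so that the functional takes exactly the value
        \<open>b\<close> on it.\<close>
      then have "b < aa \<bullet> (0 + (0, axis k (b / a $ k)))"
        using \<open>b < 0\<close> that by (intro aa(2)[OF C0]) (auto simp: P_def axis_def divide_nonpos_neg)
      then show False using \<open>\<not> a $ k \<ge> 0\<close> by (simp add: a inner_axis)
    qed
    moreover have "a0 + (-b) * L0 < 0" using aa(1) \<open>L0 > 0\<close> by (simp add: a field_simps)
    ultimately obtain \<theta> where th: "\<theta> \<in> \<Theta>" "a0 + a \<bullet> f \<theta> + (-b) * \<Lambda> \<theta> \<le> 0"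
      using dual[of a "-b" a0] \<open>b < 0\<close> by auto
    have "g \<theta> \<in> C" unfolding C_def using th by (intro hull_inc) auto
    from aa(2)[OF this P0] have "b < (a0 + a \<bullet> f \<theta>) / \<Lambda> \<theta>"
      by (simp add: a g_def add_divide_distrib)
    then show False using th \<Lambda>pos[OF th(1)] by (simp add: field_simps)
  qed
  then obtain x y where xy: "x \<in> C" "y \<in> P" "(1 / L0, 0) = x + y" by auto
  from \<open>x \<in> C\<close> obtain S u where S: "finite S" "S \<subseteq> insert 0 (g ` \<Theta>)" "\<forall>v\<in>S. 0 \<le> u v"
      "(\<Sum>v\<in>S. u v *\<^sub>R v) = x"
    unfolding C_def convex_hull_explicit by auto
  \<comment> \<open>One parameter is chosen for each point of the hull combination; the point
    \<open>0\<close> contributes nothing and is dropped. Undoing the factor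
    \<open>1 / \<Lambda>\<close> and multiplying by \<open>L0\<close> gives weights of total mass
    \<open>1\<close>.\<close>
  define T where "T = inv_into \<Theta> g ` (S - {0})"
  define q where "q \<theta> = L0 * u (g \<theta>) / \<Lambda> \<theta>" for \<theta>
  have gi: "g (inv_into \<Theta> g v) = v" "inv_into \<Theta> g v \<in> \<Theta>" if "v \<in> S - {0}" for v
    using that S(2) by (auto intro: f_inv_into_f inv_into_into)
  then have inj: "inj_on (inv_into \<Theta> g) (S - {0})" by (metis inj_on_inverseI)
  have T: "T \<subseteq> \<Theta>" "finite T" using gi S(1) by (auto simp: T_def)
  have "x = (\<Sum>v\<in>S - {0}. u v *\<^sub>R v)"
    using S(1,4) by (subst sum.mono_neutral_left[of S]) auto
  also have "\<dots> = (\<Sum>\<theta>\<in>T. u (g \<theta>) *\<^sub>R g \<theta>)"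
    unfolding T_def using gi by (simp add: sum.reindex[OF inj])
  finally have x: "x = (\<Sum>\<theta>\<in>T. u (g \<theta>) *\<^sub>R g \<theta>)" .
  have x1: "L0 * fst x = (\<Sum>\<theta>\<in>T. q \<theta>)"
    unfolding x by (simp add: fst_sum g_def q_def sum_distrib_left)
  have x2: "L0 * snd x $ k = (\<Sum>\<theta>\<in>T. q \<theta> * f \<theta> $ k)" for k
    unfolding x by (simp add: snd_sum g_def q_def sum_distrib_left mult.assoc)
  have "fst x = 1 / L0" using xy(2) arg_cong[OF xy(3), of fst] by (auto simp: P_def)
  then have "(\<Sum>\<theta>\<in>T. q \<theta>) = 1" using x1 \<open>L0 > 0\<close> by simp
  moreover have "0 \<le> q \<theta>" if "\<theta> \<in> T" for \<theta>
  proof -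
    from that obtain v where "v \<in> S - {0}" "\<theta> = inv_into \<Theta> g v" by (auto simp: T_def)
    then show ?thesis
      using S(3) gi[of v] \<Lambda>pos[of \<theta>] \<open>L0 > 0\<close> by (simp add: q_def)
  qed
  moreover have "snd x $ k = - (snd y $ k)" for k
    using arg_cong[OF xy(3), of "\<lambda>z. snd z $ k"] by simp
  moreover have "(k \<in> E \<longrightarrow> snd y $ k = 0) \<and> snd y $ k \<ge> 0" for k
    using xy(2) by (auto simp: P_def)
  ultimately show ?thesis
    using T \<open>L0 > 0\<close> by (intro exI[of _ T] exI[of _ q]) (auto simp flip: x2)
qed

section \<open>Concavity up to second order\<close>

text \<open>The square of \<open>t * s\<close> in the exponential series contributes
  \<open>t^2 s^2 / 2\<close>; the correction in the exponent cancels it, so nothing of order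
  \<open>t^2\<close> remains.\<close>

lemma gaussian_tilt_expansion:
  fixes s :: real
  shows "((\<lambda>t. (exp (t * s - t\<^sup>2 * s\<^sup>2 / 2) - (1 + t * s)) / t\<^sup>2) \<longlongrightarrow> 0) (at 0)"
  by real_asymp (simp_all add: power2_eq_square)

text \<open>Only the symmetric second difference at \<open>0\<close> is controlled, from above and
  up to \<open>o(t^2)\<close>. This is what comparing the steps \<open>t\<close> and
  \<open>-t\<close> requires.\<close>

definition second_order_concave :: "(real \<Rightarrow> real) \<Rightarrow> bool" where
  "second_order_concave f \<longleftrightarrow> (\<forall>e>0. \<forall>\<^sub>F t in at 0. f t + f (- t) - 2 * f 0 \<le> e * t\<^sup>2)"

lemma second_order_concave_add:
  assumes "second_order_concave f" "second_order_concave g"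
  shows "second_order_concave (\<lambda>t. f t + g t)"
  unfolding second_order_concave_def
proof (intro allI impI)
  fix e :: real assume "e > 0"
  then have "\<forall>\<^sub>F t in at 0. f t + f (- t) - 2 * f 0 \<le> e / 2 * t\<^sup>2"
    "\<forall>\<^sub>F t in at 0. g t + g (- t) - 2 * g 0 \<le> e / 2 * t\<^sup>2"
    using assms unfolding second_order_concave_def by (meson half_gt_zero)+
  then show "\<forall>\<^sub>F t in at 0. f t + g t + (f (- t) + g (- t)) - 2 * (f 0 + g 0) \<le> e * t\<^sup>2"
    by eventually_elim (simp add: algebra_simps)
qed

lemma second_order_concave_cmult:
  assumes "second_order_concave f" "c \<ge> 0"
  shows "second_order_concave (\<lambda>t. c * f t)"
proof (cases "c = 0")
  case False
  show ?thesis
    unfolding second_order_concave_def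
  proof (intro allI impI)
    fix e :: real assume "e > 0"
    then have "e / c > 0" using False assms by simp
    then have "\<forall>\<^sub>F t in at 0. f t + f (- t) - 2 * f 0 \<le> e / c * t\<^sup>2"
      using assms unfolding second_order_concave_def by blast
    then show "\<forall>\<^sub>F t in at 0. c * f t + c * f (- t) - 2 * (c * f 0) \<le> e * t\<^sup>2"
    proof eventually_elim
      case (elim t)
      from mult_left_mono[OF this \<open>c \<ge> 0\<close>] False show ?case by (simp add: algebra_simps)
    qed
  qed
qed (simp add: second_order_concave_def)

lemma second_order_concave_sum:
  assumes "\<And>i. i \<in> I \<Longrightarrow> second_order_concave (f i)"
  shows "second_order_concave (\<lambda>t. \<Sum>i\<in>I. f i t)"
  using assms
proof (induction I rule: infinite_finite_induct)
  case (insert i I)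
  then show ?case by (simp add: second_order_concave_add)
qed (simp_all add: second_order_concave_def)

text \<open>Stronger than having derivative \<open>b\<close> at \<open>0\<close>: a quadratic term
  is excluded as well.\<close>

definition second_order_linear :: "real \<Rightarrow> (real \<Rightarrow> real) \<Rightarrow> bool" where
  "second_order_linear b f \<longleftrightarrow> ((\<lambda>t. (f t - (f 0 + t * b)) / t\<^sup>2) \<longlongrightarrow> 0) (at 0)"

lemma eventually_at_0_uminus:
  fixes P :: "real \<Rightarrow> bool"
  assumes "eventually P (at 0)"
  shows "\<forall>\<^sub>F t in at 0. P (- t)"
  using assms unfolding eventually_at
  by (simp add: dist_real_def) (metis abs_minus_cancel neg_equal_0_iff_equal)

lemma second_order_linearD:
  assumes "second_order_linear b f" "e > 0"
  shows "\<forall>\<^sub>F t in at 0. \<bar>f t - (f 0 + t * b)\<bar> \<le> e * t\<^sup>2 \<and> \<bar>f (- t) - (f 0 - t * b)\<bar> \<le> e * t\<^sup>2"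
proof -
  have "\<forall>\<^sub>F t in at 0. dist ((f t - (f 0 + t * b)) / t\<^sup>2) 0 < e"
    using assms by (auto simp: second_order_linear_def dest: tendstoD)
  moreover have "\<forall>\<^sub>F t in at (0::real). t \<noteq> 0" by (simp add: eventually_at_filter)
  ultimately have "\<forall>\<^sub>F t in at 0. \<bar>f t - (f 0 + t * b)\<bar> \<le> e * t\<^sup>2"
    by eventually_elim (simp add: abs_divide field_simps)
  with eventually_at_0_uminus[OF this] show ?thesis
    by eventually_elim simp
qed

lemma second_order_linear_imp_concave:
  assumes "second_order_linear b f"
  shows "second_order_concave f"
  unfolding second_order_concave_def
proof (intro allI impI)
  fix e :: real assume "e > 0"
  then have "e / 2 > 0" by simp
  from second_order_linearD[OF assms this]
  show "\<forall>\<^sub>F t in at 0. f t + f (- t) - 2 * f 0 \<le> e * t\<^sup>2"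
    by eventually_elim linarith
qed

lemma second_order_linear_cmult:
  assumes "second_order_linear b f"
  shows "second_order_linear (c * b) (\<lambda>t. c * f t)"
proof -
  have "(c * f t - (c * f 0 + t * (c * b))) / t\<^sup>2 = c * ((f t - (f 0 + t * b)) / t\<^sup>2)" for t
    by (simp add: algebra_simps add_divide_distrib diff_divide_distrib)
  then show ?thesis
    using tendsto_mult_right_zero[OF assms[unfolded second_order_linear_def], of c]
    by (simp only: second_order_linear_def)
qed

lemma second_order_linear_sum:
  assumes "\<And>i. i \<in> I \<Longrightarrow> second_order_linear (b i) (f i)"
  shows "second_order_linear (\<Sum>i\<in>I. b i) (\<lambda>t. \<Sum>i\<in>I. f i t)"
proof -
  have "((\<Sum>i\<in>I. f i t) - ((\<Sum>i\<in>I. f i 0) + t * (\<Sum>i\<in>I. b i))) / t\<^sup>2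
      = (\<Sum>i\<in>I. (f i t - (f i 0 + t * b i)) / t\<^sup>2)" for t
    by (simp add: sum_divide_distrib sum_subtractf sum.distrib sum_distrib_left diff_divide_distrib add_divide_distrib)
  then show ?thesis
    using tendsto_sum[of I "\<lambda>i t. (f i t - (f i 0 + t * b i)) / t\<^sup>2" "\<lambda>_. 0" "at 0"] assms
    by (simp add: second_order_linear_def)
qed

lemma second_order_linear_const: "second_order_linear 0 (\<lambda>_. c)"
  by (simp add: second_order_linear_def)

lemma second_order_linear_add:
  assumes "second_order_linear a f" "second_order_linear b g"
  shows "second_order_linear (a + b) (\<lambda>t. f t + g t)"
proof -
  have "(f t + g t - (f 0 + g 0 + t * (a + b))) / t\<^sup>2
      = (f t - (f 0 + t * a)) / t\<^sup>2 + (g t - (g 0 + t * b)) / t\<^sup>2" for t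
    by (simp add: algebra_simps add_divide_distrib diff_divide_distrib)
  then show ?thesis
    using tendsto_add[OF assms[unfolded second_order_linear_def]]
    by (simp add: second_order_linear_def)
qed

text \<open>The slope must be \<open>0\<close>: a slope \<open>b\<close> would leave the convex term
  \<open>b^2 t^2\<close> in the square.\<close>

lemma second_order_linear_square:
  assumes "second_order_linear 0 f"
  shows "second_order_linear 0 (\<lambda>t. (f t)\<^sup>2)"
proof -
  define r where "r t = (f t - f 0) / t\<^sup>2" for t
  have r: "(r \<longlongrightarrow> 0) (at 0)"
    unfolding r_def using assms by (simp add: second_order_linear_def)
  have "((\<lambda>t. 2 * f 0 * r t + t\<^sup>2 * (r t)\<^sup>2) \<longlongrightarrow> 2 * f 0 * 0 + 0\<^sup>2 * 0\<^sup>2) (at 0)"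
    by (intro tendsto_intros r)
  moreover have "\<forall>\<^sub>F t in at 0. 2 * f 0 * r t + t\<^sup>2 * (r t)\<^sup>2 = ((f t)\<^sup>2 - (f 0)\<^sup>2) / t\<^sup>2"
    unfolding eventually_at_filter
  proof (intro always_eventually allI impI)
    fix t :: real assume "t \<noteq> 0"
    then have "f t = f 0 + t\<^sup>2 * r t" by (simp add: r_def)
    then show "2 * f 0 * r t + t\<^sup>2 * (r t)\<^sup>2 = ((f t)\<^sup>2 - (f 0)\<^sup>2) / t\<^sup>2"
      using \<open>t \<noteq> 0\<close> by (simp add: field_simps power2_eq_square)
  qed
  ultimately show ?thesis
    by (simp add: second_order_linear_def filterlim_cong)
qed

section \<open>Concavity of \<open>p q / (p + q)\<close>\<close>

definition half_harm :: "real \<Rightarrow> real \<Rightarrow> real" where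
  "half_harm p q = p * q / (p + q)"

lemma half_harm_commute: "half_harm p q = half_harm q p"
  by (simp add: half_harm_def mult.commute add.commute)

text \<open>The difference quotient in the first argument is
  \<open>q^2 / ((p + q) (p' + q))\<close>, which lies between \<open>0\<close> and
  \<open>1\<close>.\<close>

lemma half_harm_lipschitz1:
  assumes "p > 0" "p' > 0" "q > 0"
  shows "half_harm p q \<le> half_harm p' q + \<bar>p - p'\<bar>"
proof -
  have "half_harm p q - half_harm p' q = (p - p') * (q\<^sup>2 / ((p + q) * (p' + q)))"
    using assms by (simp add: half_harm_def field_simps power2_eq_square)
  also have "\<dots> \<le> \<bar>p - p'\<bar> * (q\<^sup>2 / ((p + q) * (p' + q)))"
    using assms by (intro mult_right_mono) auto
  also have "\<dots> \<le> \<bar>p - p'\<bar> * 1"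
  proof (intro mult_left_mono)
    have "q\<^sup>2 \<le> (p + q) * (p' + q)"
      using assms by (simp add: algebra_simps power2_eq_square)
    then show "q\<^sup>2 / ((p + q) * (p' + q)) \<le> 1"
      using assms by (intro divide_le_eq_1_pos[THEN iffD2]) auto
  qed simp
  finally show ?thesis by simp
qed

lemma half_harm_lipschitz:
  assumes "p > 0" "p' > 0" "q > 0" "q' > 0"
  shows "half_harm p q \<le> half_harm p' q' + \<bar>p - p'\<bar> + \<bar>q - q'\<bar>"
  using half_harm_lipschitz1[of p p' q] half_harm_lipschitz1[of q q' p'] assms
  by (simp add: half_harm_commute[of p'])

text \<open>On positive arguments the function equals its tangent plane at \<open>(p, q)\<close>
  minus a square over a positive quantity. It therefore lies below that plane, and the increments
  \<open>a\<close>, \<open>b\<close> cancel in the sum of the two plane values.\<close>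

lemma half_harm_midpoint:
  assumes "p + a > 0" "p - a > 0" "q + b > 0" "q - b > 0"
  shows "half_harm (p + a) (q + b) + half_harm (p - a) (q - b) \<le> 2 * half_harm p q"
proof -
  have pq: "p > 0" "q > 0" using assms by linarith+
  have *: "half_harm x y = x * q\<^sup>2 / (p + q)\<^sup>2 + y * p\<^sup>2 / (p + q)\<^sup>2 - (x * q - y * p)\<^sup>2 / ((p + q)\<^sup>2 * (x + y))"
    if "x > 0" "y > 0" for x y
  proof -
    have "x * y * (p + q)\<^sup>2 = (x * q\<^sup>2 + y * p\<^sup>2) * (x + y) - (x * q - y * p)\<^sup>2"
      by (simp add: algebra_simps power2_eq_square)
    moreover have "x * y / (x + y) = x * y * (p + q)\<^sup>2 / ((p + q)\<^sup>2 * (x + y))"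
      using that pq by simp
    ultimately have "x * y / (x + y) = ((x * q\<^sup>2 + y * p\<^sup>2) * (x + y) - (x * q - y * p)\<^sup>2) / ((p + q)\<^sup>2 * (x + y))"
      by simp
    also have "\<dots> = (x * q\<^sup>2 + y * p\<^sup>2) / (p + q)\<^sup>2 - (x * q - y * p)\<^sup>2 / ((p + q)\<^sup>2 * (x + y))"
      using that pq by (simp add: diff_divide_distrib)
    finally show ?thesis by (simp add: half_harm_def add_divide_distrib)
  qed
  define c d where "c = q\<^sup>2 / (p + q)\<^sup>2" and "d = p\<^sup>2 / (p + q)\<^sup>2"
  have tang: "half_harm x y \<le> x * c + y * d" if "x > 0" "y > 0" for x y
    using *[OF that] that pq by (simp add: c_def d_def)
  have "half_harm (p + a) (q + b) + half_harm (p - a) (q - b) \<le> 2 * (p * c + q * d)"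
    using tang[of "p + a" "q + b"] tang[of "p - a" "q - b"] assms
    by (simp add: algebra_simps)
  also have "\<dots> = 2 * half_harm p q" using *[OF pq] by (simp add: mult.commute c_def d_def)
  finally show ?thesis .
qed

text \<open>By the Lipschitz bound \<open>f\<close> and \<open>g\<close> may be replaced by their
  affine parts at a cost of \<open>o(t^2)\<close>; midpoint concavity handles these. Four such
  errors occur, hence \<open>e / 4\<close>.\<close>

lemma second_order_concave_half_harm:
  assumes f: "second_order_linear a f" and g: "second_order_linear b g"
    and pos: "\<And>t. f t > 0" "\<And>t. g t > 0"
  shows "second_order_concave (\<lambda>t. half_harm (f t) (g t))"
  unfolding second_order_concave_def
proof (intro allI impI)
  fix e :: real assume "e > 0"
  then have e4: "e / 4 > 0" by simp
  have small: "\<forall>\<^sub>F t in at 0. c + t * d > 0" if "c > 0" for c d :: real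
  proof -
    have "((\<lambda>t. c + t * d) \<longlongrightarrow> c + 0 * d) (at 0)" by (intro tendsto_intros)
    then show ?thesis by (rule order_tendstoD) (use that in simp)
  qed
  have ev: "\<forall>\<^sub>F t in at 0. f 0 + t * a > 0 \<and> f 0 - t * a > 0 \<and> g 0 + t * b > 0 \<and> g 0 - t * b > 0"
    using small[OF pos(1), of 0 a] small[OF pos(1), of 0 "- a"]
      small[OF pos(2), of 0 b] small[OF pos(2), of 0 "- b"]
    by eventually_elim simp
  show "\<forall>\<^sub>F t in at 0. half_harm (f t) (g t) + half_harm (f (- t)) (g (- t))
      - 2 * half_harm (f 0) (g 0) \<le> e * t\<^sup>2"
    using second_order_linearD[OF f e4] second_order_linearD[OF g e4] ev
  proof eventually_elim
    case (elim t)
    have "half_harm (f t) (g t) \<le> half_harm (f 0 + t * a) (g 0 + t * b)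
        + \<bar>f t - (f 0 + t * a)\<bar> + \<bar>g t - (g 0 + t * b)\<bar>"
      "half_harm (f (-t)) (g (-t)) \<le> half_harm (f 0 - t * a) (g 0 - t * b)
        + \<bar>f (-t) - (f 0 - t * a)\<bar> + \<bar>g (-t) - (g 0 - t * b)\<bar>"
      using elim pos by (intro half_harm_lipschitz; simp)+
    moreover have "half_harm (f 0 + t * a) (g 0 + t * b) + half_harm (f 0 - t * a) (g 0 - t * b)
        \<le> 2 * half_harm (f 0) (g 0)"
      using elim by (intro half_harm_midpoint) auto
    ultimately show ?case using elim by linarith
  qed
qed

text \<open>For a centred \<open>s\<close> the normalising constant is \<open>1 + o(t\<^sup>2)\<close>, so the weights
  form a martingale up to second order.\<close>

lemma second_order_linear_tilt:
  fixes w s :: "'k::finite \<Rightarrow> real"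
  assumes sum1: "(\<Sum>i\<in>UNIV. w i) = 1" and mean0: "(\<Sum>i\<in>UNIV. w i * s i) = 0"
  shows "second_order_linear (w k * s k)
    (\<lambda>t. w k * exp (t * s k - t\<^sup>2 * (s k)\<^sup>2 / 2) / (\<Sum>i\<in>UNIV. w i * exp (t * s i - t\<^sup>2 * (s i)\<^sup>2 / 2)))"
proof -
  define r where "r i t = (exp (t * s i - t\<^sup>2 * (s i)\<^sup>2 / 2) - (1 + t * s i)) / t\<^sup>2" for i t
  define \<rho> where "\<rho> t = (\<Sum>i\<in>UNIV. w i * r i t)" for t
  have r: "(r i \<longlongrightarrow> 0) (at 0)" for i
    unfolding r_def by (rule gaussian_tilt_expansion)
  have "(\<rho> \<longlongrightarrow> (\<Sum>i\<in>UNIV. w i * 0)) (at 0)"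
    unfolding \<rho>_def by (intro tendsto_intros r)
  then have \<rho>: "(\<rho> \<longlongrightarrow> 0) (at 0)" by simp
  have t0: "((\<lambda>t. 1 + t\<^sup>2 * \<rho> t) \<longlongrightarrow> 1 + 0\<^sup>2 * 0) (at 0)"
    by (intro tendsto_intros \<rho>)
  then have "\<forall>\<^sub>F t in at 0. 1 + t\<^sup>2 * \<rho> t > 0"
    by (rule order_tendstoD) simp
  moreover have "\<forall>\<^sub>F t in at (0::real). t \<noteq> 0" by (simp add: eventually_at_filter)
  ultimately have "\<forall>\<^sub>F t in at 0. w k * (r k t - \<rho> t * (1 + t * s k)) / (1 + t\<^sup>2 * \<rho> t) =
      (w k * exp (t * s k - t\<^sup>2 * (s k)\<^sup>2 / 2) / (\<Sum>i\<in>UNIV. w i * exp (t * s i - t\<^sup>2 * (s i)\<^sup>2 / 2))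
        - (w k + t * (w k * s k))) / t\<^sup>2"
  proof eventually_elim
    case (elim t)
    have ex: "exp (t * s i - t\<^sup>2 * (s i)\<^sup>2 / 2) = 1 + t * s i + t\<^sup>2 * r i t" for i
      using elim by (simp add: r_def)
    have "(\<Sum>i\<in>UNIV. w i * exp (t * s i - t\<^sup>2 * (s i)\<^sup>2 / 2))
        = (\<Sum>i\<in>UNIV. w i) + t * (\<Sum>i\<in>UNIV. w i * s i) + t\<^sup>2 * \<rho> t"
      unfolding ex \<rho>_def by (simp add: algebra_simps sum.distrib sum_distrib_left)
    then have "(\<Sum>i\<in>UNIV. w i * exp (t * s i - t\<^sup>2 * (s i)\<^sup>2 / 2)) = 1 + t\<^sup>2 * \<rho> t"
      by (simp add: sum1 mean0)
    \<comment> \<open>With normaliser \<open>1 + t^2 \<rho>\<close>, the terms of order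
      \<open>0\<close> and \<open>1\<close> cancel, so a factor \<open>t^2\<close> splits off
      exactly and the remaining factor tends to \<open>0\<close>.\<close>
    moreover have "w k * (1 + t * s k + t\<^sup>2 * r k t) / N - (w k + t * (w k * s k))
        = t\<^sup>2 * (w k * (r k t - \<rho> t * (1 + t * s k)) / N)" if "N = 1 + t\<^sup>2 * \<rho> t" for N
    proof -
      have "N \<noteq> 0" using that elim by simp
      then have "w k * (1 + t * s k + t\<^sup>2 * r k t) / N - (w k + t * (w k * s k))
          = (w k * (1 + t * s k + t\<^sup>2 * r k t) - (w k + t * (w k * s k)) * N) / N"
        by (simp add: diff_divide_distrib)
      also have "w k * (1 + t * s k + t\<^sup>2 * r k t) - (w k + t * (w k * s k)) * N
          = t\<^sup>2 * (w k * (r k t - \<rho> t * (1 + t * s k)))"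
        unfolding that by (simp add: algebra_simps)
      finally show ?thesis by simp
    qed
    ultimately show ?case
      unfolding ex using elim by simp
  qed
  moreover have "((\<lambda>t. w k * (r k t - \<rho> t * (1 + t * s k)) / (1 + t\<^sup>2 * \<rho> t))
      \<longlongrightarrow> w k * (0 - 0 * (1 + 0 * s k)) / (1 + 0\<^sup>2 * 0)) (at 0)"
    by (intro tendsto_intros r \<rho>) simp
  ultimately show ?thesis
    by (simp add: second_order_linear_def sum1 filterlim_cong)
qed

section \<open>Ising measures on the cube\<close>

text \<open>Indexing sign vectors by their sets of positive coordinates turns sums over the cube
  into sums over the finite type \<open>'n set\<close>.\<close>

definition vtx :: "'n set \<Rightarrow> real ^ 'n" where
  "vtx S = (\<chi> i. if i \<in> S then 1 else - 1)"

lemma inj_vtx: "inj vtx"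
  by (rule injI) (auto simp: vtx_def vec_eq_iff split: if_splits)

lemma range_vtx: "range vtx = cube"
proof
  show "cube \<subseteq> range vtx"
  proof
    fix x :: "real ^ 'n" assume "x \<in> cube"
    then have "x = vtx {i. x $ i = 1}" by (auto simp: cube_def vtx_def vec_eq_iff split: if_splits)
    then show "x \<in> range vtx" by blast
  qed
qed (auto simp: cube_def vtx_def split: if_splits)

lemma inner_vtx_self: "vtx S \<bullet> vtx S = CARD('n)" for S :: "'n::finite set"
  by (simp add: vtx_def inner_vec_def if_distrib cong: if_cong) 

text \<open>These are the point masses of \<open>ising_measure A h\<close>, as
  \<open>measure_ising_measure_vtx\<close> confirms. In this explicit form continuity in
  \<open>(A, h)\<close> and the effect of a localization step can be read off.\<close>

definition wt :: "real ^ 'n ^ 'n \<Rightarrow> real ^ 'n \<Rightarrow> 'n set \<Rightarrow> real" where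
  "wt A h S = exp (1/2 * (vtx S \<bullet> (A *v vtx S)) + h \<bullet> vtx S)
     / (\<Sum>T\<in>UNIV. exp (1/2 * (vtx T \<bullet> (A *v vtx T)) + h \<bullet> vtx T))"

lemma wt_pos: "wt A h S > 0"
  unfolding wt_def by (intro divide_pos_pos sum_pos) auto

lemma sum_wt: "(\<Sum>S\<in>UNIV. wt A h S) = 1"
proof -
  have "(\<Sum>T\<in>UNIV. exp (1/2 * (vtx T \<bullet> (A *v vtx T)) + h \<bullet> vtx T)) > 0"
    by (intro sum_pos) auto
  then show ?thesis unfolding wt_def by (simp flip: sum_divide_distrib)
qed

lemma wt_le_1: "wt A h S \<le> 1"
proof -
  have "wt A h S \<le> (\<Sum>S\<in>UNIV. wt A h S)"
    by (intro member_le_sum) (auto intro: less_imp_le wt_pos)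
  then show ?thesis by (simp add: sum_wt)
qed

lemma continuous_on_wt [continuous_intros]:
  assumes "continuous_on X f" "continuous_on X g"
  shows "continuous_on X (\<lambda>z. wt (f z) (g z) S)"
proof -
  have "(\<Sum>T\<in>UNIV. exp (1/2 * (vtx T \<bullet> (A *v vtx T)) + h \<bullet> vtx T)) \<noteq> (0::real)" for A h
    by (intro less_imp_neq[symmetric] sum_pos) auto
  moreover have "continuous_on X (\<lambda>z. f z *v x)" for x
    unfolding matrix_vector_mult_def
    by (intro continuous_on_vec_lambda continuous_intros assms)
  ultimately show ?thesis
    unfolding wt_def by (intro continuous_intros assms) auto
qed

text \<open>The uniform mass of a vertex occurs both in the base measure and in the normalising
  integral, and cancels.\<close>

lemma gibbs_eq_point_measure:
  fixes H :: "real ^ 'n \<Rightarrow> real"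
  shows "gibbs H = point_measure cube (\<lambda>x. ennreal (exp (H x) / (\<Sum>y\<in>cube. exp (H y))))"
    (is "_ = point_measure _ ?p")
proof -
  have fin: "finite (cube :: (real^'n) set)" by (simp flip: range_vtx)
  have card: "card (cube :: (real^'n) set) > 0" using fin by (simp add: card_gt_0_iff flip: range_vtx)
  have Z: "(\<integral>y. exp (H y) \<partial>cube_unif) = (\<Sum>y\<in>cube. exp (H y)) / card (cube :: (real^'n) set)"
    unfolding cube_unif_def uniform_count_measure_def
    using fin by (subst lebesgue_integral_point_measure_finite) (auto simp: sum_divide_distrib)
  have "gibbs H = density (count_space cube)
      (\<lambda>x. ennreal (1 / card (cube :: (real^'n) set)) * ennreal (exp (H x) / (\<integral>y. exp (H y) \<partial>cube_unif)))"
    unfolding gibbs_def cube_unif_def uniform_count_measure_def point_measure_def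
    by (subst density_density_eq) auto
  also have "(\<lambda>x. ennreal (1 / card (cube :: (real^'n) set)) * ennreal (exp (H x) / (\<integral>y. exp (H y) \<partial>cube_unif))) = ?p"
    using card by (simp add: Z sum_nonneg flip: ennreal_mult)
  finally show ?thesis by (simp add: point_measure_def)
qed

lemma sum_cube: "(\<Sum>x\<in>cube. f x) = (\<Sum>S\<in>UNIV. f (vtx S))"
  unfolding range_vtx[symmetric] by (simp add: sum.reindex[OF inj_vtx])

lemma ising_measure_eq_point_measure:
  "ising_measure A h = point_measure cube
     (\<lambda>x. ennreal (exp (1/2 * (x \<bullet> (A *v x)) + h \<bullet> x)
        / (\<Sum>T\<in>UNIV. exp (1/2 * (vtx T \<bullet> (A *v vtx T)) + h \<bullet> vtx T))))"
  unfolding ising_measure_def gibbs_eq_point_measure sum_cube ..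

lemma integral_ising_measure:
  fixes f :: "real ^ 'n \<Rightarrow> real"
  shows "(\<integral>x. f x \<partial>ising_measure A h) = (\<Sum>S\<in>UNIV. wt A h S * f (vtx S))"
proof -
  have "finite (cube :: (real^'n) set)" by (simp flip: range_vtx)
  then show ?thesis
    unfolding ising_measure_eq_point_measure
    by (subst lebesgue_integral_point_measure_finite)
       (auto simp: sum_cube wt_def intro!: divide_nonneg_nonneg sum_nonneg)
qed

lemma measure_ising_measure:
  assumes "X \<subseteq> cube"
  shows "measure (ising_measure A h) X = (\<Sum>S | vtx S \<in> X. wt A h S)"
proof -
  have "measure (ising_measure A h) X = (\<integral>x. indicator X x \<partial>ising_measure A h)"
    using assms unfolding ising_measure_eq_point_measure
    by (simp add: space_point_measure Int_absorb2)
  also have "\<dots> = (\<Sum>S | vtx S \<in> X. wt A h S)"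
    unfolding integral_ising_measure by (rule sum.mono_neutral_cong_right) auto
  finally show ?thesis .
qed

lemma measure_ising_measure_vtx: "measure (ising_measure A h) {vtx S} = wt A h S"
proof -
  have "{T. vtx T \<in> {vtx S}} = {S}" using inj_vtx by (auto dest: injD)
  moreover have "{vtx S} \<subseteq> cube" by (auto simp flip: range_vtx)
  ultimately show ?thesis by (simp add: measure_ising_measure)
qed

section \<open>Rank-one matrices and the semidefinite order\<close>

definition outer :: "real ^ 'n \<Rightarrow> real ^ 'n ^ 'n" where
  "outer u = (\<chi> i j. u $ i * u $ j)"

lemma outer_mult: "outer u *v x = (u \<bullet> x) *\<^sub>R u"
  by (simp add: outer_def matrix_vector_mult_def vec_eq_iff inner_vec_def sum_distrib_left mult_ac)

lemma trace_outer: "trace (outer u) = u \<bullet> u"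
  by (simp add: outer_def trace_def inner_vec_def)

lemma transpose_outer: "transpose (outer u) = outer u"
  by (simp add: outer_def transpose_def vec_eq_iff mult.commute)

lemma continuous_on_outer [continuous_intros]:
  "continuous_on X f \<Longrightarrow> continuous_on X (\<lambda>z. outer (f z))"
  unfolding outer_def by (intro continuous_on_vec_lambda continuous_intros)

lemma rank_one_measure_eq_ising_measure: "rank_one_measure u v = ising_measure (outer u) v"
  by (simp add: rank_one_measure_def ising_measure_def outer_mult power2_eq_square inner_commute)

lemma inner_matrix_symmetric:
  fixes A :: "real ^ 'n ^ 'n"
  assumes "transpose A = A"
  shows "x \<bullet> (A *v y) = (A *v x) \<bullet> y"
  using dot_lmul_matrix[of x A y] transpose_matrix_vector[of A x] assms by simp

text \<open>A quantitative Cauchy-Schwarz inequality for the form of \<open>A\<close>: it tells how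
  much of the direction \<open>A *v y\<close> can be subtracted from \<open>A\<close> without losing
  positivity. The form is evaluated at \<open>z - r y\<close>, with \<open>r\<close> chosen so that
  the cross term is \<open>-2 c d^2\<close> and the quadratic term at most
  \<open>c d^2\<close>.\<close>

lemma psd_minus_outer:
  fixes A :: "real ^ 'n ^ 'n"
  assumes sym: "transpose A = A" and psd: "\<And>x. 0 \<le> x \<bullet> (A *v x)"
    and c: "c * (y \<bullet> (A *v y)) \<le> 1" "c \<ge> 0"
  shows "c * ((A *v y) \<bullet> z)\<^sup>2 \<le> z \<bullet> (A *v z)"
proof -
  define d where "d = (A *v y) \<bullet> z"
  define r where "r = c * d"
  have d: "z \<bullet> (A *v y) = d" "y \<bullet> (A *v z) = d"
    unfolding d_def by (rule inner_commute, rule inner_matrix_symmetric[OF sym])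
  have "0 \<le> (z - r *\<^sub>R y) \<bullet> (A *v (z - r *\<^sub>R y))" by (rule psd)
  also have "\<dots> = z \<bullet> (A *v z) - 2 * r * d + r\<^sup>2 * (y \<bullet> (A *v y))"
    by (simp add: matrix_vector_mult_diff_distrib matrix_vector_mult_scaleR inner_diff_left inner_diff_right
       d power2_eq_square algebra_simps)
  also have "r\<^sup>2 * (y \<bullet> (A *v y)) = c * d\<^sup>2 * (c * (y \<bullet> (A *v y)))"
    by (simp add: r_def power2_eq_square)
  also have "\<dots> \<le> c * d\<^sup>2 * 1" using c by (intro mult_left_mono) auto
  finally show ?thesis by (simp add: r_def d_def power2_eq_square)
qed

text \<open>The hypothesis \<open>ker\<close> says that one linear functional is injective on the
  range of \<open>A\<close>, so the range has dimension at most one. If \<open>b = A *v c\<close> is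
  nonzero, then \<open>A\<close> kills everything orthogonal to \<open>b\<close>, and
  \<open>b\<close> is an eigenvector with eigenvalue \<open>\<mu> \<ge> 0\<close>.\<close>

lemma psd_eq_outer:
  fixes A :: "real ^ 'n ^ 'n"
  assumes sym: "transpose A = A" and psd: "\<And>x. 0 \<le> x \<bullet> (A *v x)"
    and ker: "\<And>y. c \<bullet> (A *v y) = 0 \<Longrightarrow> A *v y = 0"
  shows "\<exists>u. A = outer u"
proof (cases "A *v c = 0")
  case True
  then have "A *v y = 0" for y
    using ker by (simp add: inner_matrix_symmetric[OF sym])
  then have "A = outer 0" by (simp add: matrix_eq outer_mult)
  then show ?thesis ..
next
  case False
  define b where "b = A *v c"
  have bb: "b \<bullet> b > 0" using False by (simp add: b_def)
  have ker': "A *v y = 0" if "b \<bullet> y = 0" for y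
    using that by (intro ker) (simp add: b_def inner_matrix_symmetric[OF sym])
  have proj: "A *v z = ((b \<bullet> z) / (b \<bullet> b)) *\<^sub>R (A *v b)" for z
  proof -
    have "A *v (z - ((b \<bullet> z) / (b \<bullet> b)) *\<^sub>R b) = 0"
      using bb by (intro ker') (simp add: inner_diff_right)
    then show ?thesis by (simp add: matrix_vector_mult_diff_distrib matrix_vector_mult_scaleR)
  qed
  define \<mu> where "\<mu> = (b \<bullet> (A *v b)) / (b \<bullet> b)"
  have "\<mu> \<ge> 0" using psd bb by (simp add: \<mu>_def)
  \<comment> \<open>The part of \<open>A *v b\<close> orthogonal to \<open>b\<close>. It is killed
    by \<open>A\<close>, so by symmetry it is orthogonal to \<open>A *v b\<close> too, and hence to
    itself.\<close>
  define k where "k = A *v b - \<mu> *\<^sub>R b"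
  have bk: "b \<bullet> k = 0" using bb by (simp add: k_def \<mu>_def inner_diff_right)
  have "k \<bullet> k = k \<bullet> (A *v b) - \<mu> * (b \<bullet> k)"
    by (subst (2) k_def) (simp add: inner_diff_right inner_commute[of b])
  also have "k \<bullet> (A *v b) = (A *v k) \<bullet> b" by (rule inner_matrix_symmetric[OF sym])
  finally have "k = 0" using ker'[OF bk] bk by simp
  then have Ab: "A *v b = \<mu> *\<^sub>R b" by (simp add: k_def)
  define r where "r = sqrt (\<mu> / (b \<bullet> b))"
  have r: "r * r = \<mu> / (b \<bullet> b)" using \<open>\<mu> \<ge> 0\<close> bb by (simp add: r_def)
  have "A *v z = outer (r *\<^sub>R b) *v z" for z
  proof -
    have "outer (r *\<^sub>R b) *v z = (r * r * (b \<bullet> z)) *\<^sub>R b" by (simp add: outer_mult mult_ac)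
    then show ?thesis unfolding r by (subst proj) (simp add: Ab mult_ac)
  qed
  then show ?thesis by (metis matrix_eq)
qed

definition psd_below :: "real ^ 'n ^ 'n \<Rightarrow> (real ^ 'n ^ 'n) set" where
  "psd_below J = {A. transpose A = A \<and> (\<forall>x. 0 \<le> x \<bullet> (A *v x) \<and> x \<bullet> (A *v x) \<le> x \<bullet> (J *v x))}"

lemma compact_below:
  fixes J :: "real ^ 'n ^ 'n"
  shows "compact (psd_below J)"
proof -
  have lin: "continuous_on UNIV (\<lambda>A::real^'n^'n. A *v x)" for x
    unfolding matrix_vector_mult_def
    by (intro continuous_on_vec_lambda continuous_intros)
  have tr: "continuous_on UNIV (\<lambda>A::real^'n^'n. transpose A)"
    unfolding transpose_def by (intro continuous_on_vec_lambda continuous_intros)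
  have "closed (psd_below J)"
    unfolding psd_below_def
    by (intro closed_Collect_conj closed_Collect_all closed_Collect_eq closed_Collect_le
        continuous_intros lin tr)
  moreover have "bounded (psd_below J)"
  proof (rule boundedI)
    fix A assume A: "A \<in> psd_below J"
    define e where "e i = (axis i 1 :: real ^ 'n)" for i
    \<comment> \<open>Polarization: \<open>2 * A $ i $ j\<close> is a combination of three values of
      the form, each lying between \<open>0\<close> and the corresponding value for
      \<open>J\<close>.\<close>
    define R where "R i j = \<bar>(e i + e j) \<bullet> (J *v (e i + e j))\<bar> + \<bar>e i \<bullet> (J *v e i)\<bar> + \<bar>e j \<bullet> (J *v e j)\<bar>" for i j
    have Ae: "e i \<bullet> (A *v e j) = A $ i $ j" for i j
      by (simp add: e_def inner_axis' matrix_vector_mult_basis column_def)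
    have symA: "A $ j $ i = A $ i $ j" for i j
      using A by (auto simp: psd_below_def transpose_def vec_eq_iff)
    have b: "0 \<le> x \<bullet> (A *v x)" "x \<bullet> (A *v x) \<le> x \<bullet> (J *v x)" for x
      using A by (auto simp: psd_below_def)
    have "\<bar>A $ i $ j\<bar> \<le> R i j" for i j
    proof -
      have "(e i + e j) \<bullet> (A *v (e i + e j)) = A $ i $ i + A $ j $ j + 2 * A $ i $ j"
        by (simp add: matrix_vector_right_distrib inner_add_left inner_add_right Ae symA)
      then show ?thesis
        using b[of "e i + e j"] b[of "e i"] b[of "e j"] unfolding R_def Ae by linarith
    qed
    moreover have "norm A \<le> (\<Sum>i\<in>UNIV. \<Sum>j\<in>UNIV. \<bar>A $ i $ j\<bar>)"
    proof -
      have "norm A \<le> (\<Sum>i\<in>UNIV. norm (A $ i))"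
        unfolding norm_vec_def[of A] by (rule L2_set_le_sum) simp
      also have "\<dots> \<le> (\<Sum>i\<in>UNIV. \<Sum>j\<in>UNIV. \<bar>A $ i $ j\<bar>)"
        by (intro sum_mono norm_le_l1_cart)
      finally show ?thesis .
    qed
    ultimately show "norm A \<le> (\<Sum>i\<in>UNIV. \<Sum>j\<in>UNIV. R i j)"
      by (meson order_trans sum_mono)
  qed
  ultimately show ?thesis by (simp add: compact_eq_bounded_closed)
qed

text \<open>Testing the order at \<open>u\<close> itself gives
  \<open>|u|^4 \<le> u \<bullet> (J *v u)\<close>, which is at most the operator norm times
  \<open>|u|^2\<close>.\<close>

lemma norm_outer_in_below:
  assumes "outer u \<in> psd_below J"
  shows "(norm u)\<^sup>2 \<le> onorm ((*v) J)"
proof (cases "u = 0")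
  case False
  have "(norm u)\<^sup>2 * (norm u)\<^sup>2 = u \<bullet> (outer u *v u)"
    by (simp add: outer_mult power2_norm_eq_inner)
  also have "\<dots> \<le> u \<bullet> (J *v u)" using assms by (simp add: psd_below_def)
  also have "\<dots> \<le> norm u * norm (J *v u)" by (rule norm_cauchy_schwarz)
  also have "\<dots> \<le> norm u * (onorm ((*v) J) * norm u)"
    by (intro mult_left_mono onorm matrix_vector_mul_bounded_linear) simp
  finally have "(norm u)\<^sup>2 * (norm u)\<^sup>2 \<le> onorm ((*v) J) * (norm u)\<^sup>2"
    by (simp add: power2_eq_square mult_ac)
  then show ?thesis by (rule mult_right_le_imp_le) (use False in simp)
qed (simp add: onorm_pos_le)

section \<open>Minimisers have rank at most one\<close>

text \<open>Completing the square: the shift \<open>t^2 m u\<close> of the linear part replaces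
  \<open>u \<bullet> x\<close> by its centred version \<open>s\<close>, and the constant
  \<open>K\<close> left over disappears on normalising.\<close>

lemma wt_localization_step:
  fixes A :: "real ^ 'n ^ 'n" and h u :: "real ^ 'n" and t :: real
  defines "m \<equiv> \<Sum>S\<in>UNIV. wt A h S * (u \<bullet> vtx S)"
  defines "s \<equiv> \<lambda>S. u \<bullet> vtx S - m"
  shows "wt (A - t\<^sup>2 *\<^sub>R outer u) (h + (t + t\<^sup>2 * m) *\<^sub>R u) S
    = wt A h S * exp (t * s S - t\<^sup>2 * (s S)\<^sup>2 / 2)
      / (\<Sum>T\<in>UNIV. wt A h T * exp (t * s T - t\<^sup>2 * (s T)\<^sup>2 / 2))"
proof -
  define e where "e S = exp (1/2 * (vtx S \<bullet> (A *v vtx S)) + h \<bullet> vtx S)" for S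
  define Z where "Z = (\<Sum>T\<in>UNIV. e T)"
  define g where "g S = exp (t * s S - t\<^sup>2 * (s S)\<^sup>2 / 2)" for S
  define K where "K = exp (t * m + t\<^sup>2 * m\<^sup>2 / 2)"
  have "Z > 0" unfolding Z_def e_def by (intro sum_pos) auto
  have "K > 0" by (simp add: K_def)
  have w: "wt A h S = e S / Z" for S by (simp add: wt_def e_def Z_def)
  have e': "exp (1/2 * (vtx S \<bullet> ((A - t\<^sup>2 *\<^sub>R outer u) *v vtx S)) + (h + (t + t\<^sup>2 * m) *\<^sub>R u) \<bullet> vtx S)
      = K * (e S * g S)" for S
    unfolding K_def e_def g_def exp_add[symmetric]
    by (simp add: matrix_vector_mult_diff_rdistrib scaleR_matrix_vector_assoc[symmetric] outer_mult
        inner_diff_right inner_add_left s_def inner_commute[of _ u] power2_eq_square field_simps)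
  have "wt (A - t\<^sup>2 *\<^sub>R outer u) (h + (t + t\<^sup>2 * m) *\<^sub>R u) S
      = (e S * g S) / (\<Sum>T\<in>UNIV. e T * g T)"
    unfolding wt_def e' using \<open>K > 0\<close> by (simp flip: sum_distrib_left)
  also have "\<dots> = (e S / Z * g S) / (\<Sum>T\<in>UNIV. e T / Z * g T)"
    using \<open>Z > 0\<close> by (simp flip: sum_divide_distrib)
  finally show ?thesis unfolding g_def w .
qed

text \<open>The first factor grows under a step, the second shrinks. The rate \<open>n + 3\<close>
  makes the second win: with \<open>|m|^2 \<le> n |u|^2\<close>, the drift costs \<open>n\<close>,
  the terms quadratic in \<open>u\<close> cost \<open>2\<close>, and \<open>1\<close> is left for
  strict decrease.\<close>

definition lyapunov :: "real ^ 'n ^ 'n \<Rightarrow> real ^ 'n \<Rightarrow> real" where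
  "lyapunov A h = (1 + h \<bullet> h) * exp ((real CARD('n) + 3) * trace A)"

lemma lyapunov_strictly_decreasing:
  fixes A :: "real ^ 'n ^ 'n"
  assumes m: "m\<^sup>2 \<le> real CARD('n) * (u \<bullet> u)" and "u \<noteq> 0"
  shows "\<exists>c>0. \<forall>\<^sub>F t in at 0.
    lyapunov (A - t\<^sup>2 *\<^sub>R outer u) (h + (t + t\<^sup>2 * m) *\<^sub>R u)
    + lyapunov (A - t\<^sup>2 *\<^sub>R outer u) (h + (- t + t\<^sup>2 * m) *\<^sub>R u) - 2 * lyapunov A h \<le> - c * t\<^sup>2"
proof -
  define C where "C = real CARD('n) + 3"
  define E where "E = exp (C * trace A)"
  define U where "U = u \<bullet> u"
  define D where "D = 1 + h \<bullet> h"
  have U: "U > 0" using \<open>u \<noteq> 0\<close> by (simp add: U_def)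
  have "E > 0" by (simp add: E_def)
  have C: "C \<ge> 3" by (simp add: C_def)
  have D: "D \<ge> 1" by (simp add: D_def)
  have hu: "(h \<bullet> u)\<^sup>2 \<le> (h \<bullet> h) * U"
    unfolding U_def by (rule Cauchy_Schwarz_ineq)
  have mh: "2 * m * (h \<bullet> u) \<le> (C - 3) * U * D"
  proof -
    have "2 * m * (h \<bullet> u) \<le> m\<^sup>2 + (h \<bullet> u)\<^sup>2"
      using sum_squares_bound[of m "h \<bullet> u"] by simp
    also have "\<dots> \<le> (C - 3) * U + (h \<bullet> h) * U" using m hu by (simp add: C_def U_def)
    also have "\<dots> \<le> (C - 3) * U + (C - 3) * ((h \<bullet> h) * U)"
    proof -
      have "C - 3 \<ge> 1" by (simp add: C_def Suc_leI)
      then have "1 * ((h \<bullet> h) * U) \<le> (C - 3) * ((h \<bullet> h) * U)"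
        using U by (intro mult_right_mono) auto
      then show ?thesis by simp
    qed
    also have "\<dots> = (C - 3) * U * D" by (simp add: D_def algebra_simps)
    finally show ?thesis .
  qed
  have ev0: "\<forall>\<^sub>F t in at (0::real). t\<^sup>2 * k < 1" for k
  proof -
    have "((\<lambda>t. t\<^sup>2 * k) \<longlongrightarrow> 0\<^sup>2 * k) (at (0::real))" by (intro tendsto_intros)
    then show ?thesis by (rule order_tendstoD) simp
  qed
  have tr: "trace (A - t\<^sup>2 *\<^sub>R outer u) = trace A - t\<^sup>2 * U" for t :: real
    by (simp add: trace_sub U_def trace_def outer_def inner_vec_def sum_distrib_left sum_subtractf)
  have "\<forall>\<^sub>F t in at 0.
    lyapunov (A - t\<^sup>2 *\<^sub>R outer u) (h + (t + t\<^sup>2 * m) *\<^sub>R u)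
    + lyapunov (A - t\<^sup>2 *\<^sub>R outer u) (h + (- t + t\<^sup>2 * m) *\<^sub>R u) - 2 * lyapunov A h \<le> - (E * U) * t\<^sup>2"
    using ev0[of "m\<^sup>2"] ev0[of "C * U"]
  proof eventually_elim
    case (elim t)
    define \<tau> where "\<tau> = t\<^sup>2 * U"
    have \<tau>: "\<tau> \<ge> 0" "C * \<tau> < 1" using U elim by (simp_all add: \<tau>_def mult_ac)
    \<comment> \<open>Half the sum of the first factors at \<open>t\<close> and \<open>-t\<close>;
      the terms odd in \<open>t\<close> have cancelled. The common second factor is
      \<open>E * x\<close>.\<close>
    define X where "X = D + \<tau> * (1 + t\<^sup>2 * m\<^sup>2) + t\<^sup>2 * (2 * m * (h \<bullet> u))"
    define x where "x = exp (- (C * \<tau>))"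
    have X: "(1 + (h + (t + t\<^sup>2 * m) *\<^sub>R u) \<bullet> (h + (t + t\<^sup>2 * m) *\<^sub>R u))
        + (1 + (h + (- t + t\<^sup>2 * m) *\<^sub>R u) \<bullet> (h + (- t + t\<^sup>2 * m) *\<^sub>R u)) = 2 * X"
      by (simp add: X_def D_def \<tau>_def U_def inner_add_left inner_add_right inner_commute[of u h]
        power2_eq_square algebra_simps)
    have "X \<le> D + \<tau> * 2 + t\<^sup>2 * ((C - 3) * U * D)"
      unfolding X_def using elim \<tau> mh by (intro add_mono mult_left_mono) auto
    also have "\<dots> \<le> D * (1 + \<tau> * (C - 1))"
      using mult_left_mono[OF D, of "\<tau> * 2"] \<tau> by (simp add: \<tau>_def algebra_simps)
    finally have "X \<le> D * (1 + \<tau> * (C - 1))" .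
    then have "X * x \<le> D * (1 + \<tau> * (C - 1)) * x" by (intro mult_right_mono) (auto simp: x_def)
    also have "\<dots> \<le> D * (1 + \<tau> * (C - 1)) * (1 / (1 + C * \<tau>))"
    proof (intro mult_left_mono)
      have "1 + C * \<tau> \<le> exp (C * \<tau>)" by (rule exp_ge_add_one_self)
      then show "x \<le> 1 / (1 + C * \<tau>)"
        using C \<tau> by (simp add: x_def exp_minus divide_simps add_pos_nonneg)
      show "0 \<le> D * (1 + \<tau> * (C - 1))" using C D \<tau> by auto
    qed
    also have "\<dots> = D - D * \<tau> / (1 + C * \<tau>)"
    proof -
      have "1 + C * \<tau> > 0" using C \<tau> by (simp add: add_pos_nonneg)
      then show ?thesis by (simp add: field_simps)
    qed
    also have "\<dots> \<le> D - \<tau> / 2"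
    proof -
      have "\<tau> / 2 \<le> \<tau> / (1 + C * \<tau>)"
        using C \<tau> by (intro divide_left_mono) (auto simp: add_pos_nonneg)
      also have "\<dots> \<le> D * \<tau> / (1 + C * \<tau>)"
        using D C \<tau> mult_right_mono[OF D \<tau>(1)] by (intro divide_right_mono) auto
      finally show ?thesis by simp
    qed
    finally have Xx: "X * x - D \<le> - \<tau> / 2" by simp
    have ex: "exp (C * (trace A - t\<^sup>2 * U)) = E * x"
      unfolding E_def x_def exp_add[symmetric] by (simp add: \<tau>_def algebra_simps)
    have "lyapunov (A - t\<^sup>2 *\<^sub>R outer u) (h + (t + t\<^sup>2 * m) *\<^sub>R u)
      + lyapunov (A - t\<^sup>2 *\<^sub>R outer u) (h + (- t + t\<^sup>2 * m) *\<^sub>R u) - 2 * lyapunov A h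
      = (2 * X) * (E * x) - 2 * D * E"
      unfolding lyapunov_def C_def[symmetric] tr ex X[symmetric] unfolding D_def E_def by (simp add: distrib_right)
    also have "\<dots> = 2 * E * (X * x - D)" by (simp add: algebra_simps)
    also have "\<dots> \<le> 2 * E * (- \<tau> / 2)"
      using Xx \<open>E > 0\<close> by (intro mult_left_mono) auto
    finally show ?case by (simp add: \<tau>_def mult_ac)
  qed
  then show ?thesis using \<open>E > 0\<close> U by (intro exI[of _ "E * U"]) auto
qed

definition expect :: "real ^ 'n ^ 'n \<Rightarrow> real ^ 'n \<Rightarrow> ('n set \<Rightarrow> real) \<Rightarrow> real" where
  "expect A h F = (\<Sum>S\<in>UNIV. wt A h S * F S)"

text \<open>The Lagrangian of the moment problem up to constants: \<open>\<psi>\<close> are the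
  multipliers of the barycentre equations, of either sign, \<open>l\<close> those of the
  inequalities for pairs of points, and \<open>\<kappa>\<close> that of the constraint on the mean
  of \<open>F\<close>.\<close>

definition objective ::
  "('n set \<Rightarrow> real) \<Rightarrow> ('n set \<Rightarrow> 'n set \<Rightarrow> real) \<Rightarrow> real \<Rightarrow> ('n set \<Rightarrow> real) \<Rightarrow> real \<Rightarrow>
    real ^ 'n ^ 'n \<Rightarrow> real ^ 'n \<Rightarrow> real" where
  "objective \<psi> l \<kappa> F c A h = (\<Sum>S\<in>UNIV. \<psi> S * wt A h S)
     + (\<Sum>S\<in>UNIV. \<Sum>T\<in>UNIV. l S T * half_harm (wt A h S) (wt A h T))
     + \<kappa> * (expect A h F - c)\<^sup>2"

text \<open>The values at \<open>t\<close> and \<open>-t\<close> together fall below twice the value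
  at \<open>0\<close>, so one sign improves. The bound \<open>\<epsilon>\<close> lets the caller
  keep the new matrix positive semidefinite.\<close>

lemma objective_improvement:
  fixes A :: "real ^ 'n ^ 'n" and h :: "real ^ 'n"
  assumes l: "\<And>S T. l S T \<ge> 0" and "\<kappa> \<ge> 0" "\<beta> > 0"
    and cov: "(\<Sum>S\<in>UNIV. wt A h S * F S * (u \<bullet> vtx S - expect A h (\<lambda>S. u \<bullet> vtx S))) = 0"
    and "u \<noteq> 0" "\<epsilon> > 0"
  shows "\<exists>t h'. t\<^sup>2 < \<epsilon> \<and> objective \<psi> l \<kappa> F c (A - t\<^sup>2 *\<^sub>R outer u) h' + \<beta> * lyapunov (A - t\<^sup>2 *\<^sub>R outer u) h'
     < objective \<psi> l \<kappa> F c A h + \<beta> * lyapunov A h"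
proof -
  define m where "m = expect A h (\<lambda>S. u \<bullet> vtx S)"
  define s where "s S = u \<bullet> vtx S - m" for S
  define A' where "A' t = A - t\<^sup>2 *\<^sub>R outer u" for t
  define h' where "h' t = h + (t + t\<^sup>2 * m) *\<^sub>R u" for t
  define W where "W S t = wt (A' t) (h' t) S" for S t
  have A'0: "A' 0 = A" and h'0: "h' 0 = h"
    by (simp_all add: A'_def h'_def)
  have mean0: "(\<Sum>S\<in>UNIV. wt A h S * s S) = 0"
    by (simp add: s_def m_def expect_def right_diff_distrib sum_subtractf sum_wt flip: sum_distrib_right)
  have W: "second_order_linear (wt A h S * s S) (W S)" for S
    using second_order_linear_tilt[OF sum_wt mean0, of S]
    unfolding W_def A'_def h'_def m_def s_def expect_def wt_localization_step .
  have Wpos: "W S t > 0" for S t by (simp add: W_def wt_pos)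
  define f where "f t = objective \<psi> l \<kappa> F c (A' t) (h' t)" for t
  have f1: "second_order_concave (\<lambda>t. \<Sum>S\<in>UNIV. \<psi> S * W S t)"
    by (rule second_order_linear_imp_concave, rule second_order_linear_sum, rule second_order_linear_cmult[OF W])
  have f2: "second_order_concave (\<lambda>t. \<Sum>S\<in>UNIV. \<Sum>T\<in>UNIV. l S T * half_harm (W S t) (W T t))"
    by (intro second_order_concave_sum second_order_concave_cmult second_order_concave_half_harm[OF W W Wpos Wpos] l)
  \<comment> \<open>The slope of the mean of \<open>F\<close> is its covariance with
    \<open>u \<bullet> x\<close>, which \<open>cov\<close> makes zero; only then is the square below
    harmless.\<close>
  have "second_order_linear ((\<Sum>S\<in>UNIV. F S * (wt A h S * s S)) + 0) (\<lambda>t. (\<Sum>S\<in>UNIV. F S * W S t) + (- c))"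
    by (intro second_order_linear_add second_order_linear_sum second_order_linear_cmult W second_order_linear_const)
  also have "(\<Sum>S\<in>UNIV. F S * (wt A h S * s S)) + 0 = 0"
    using cov by (simp add: s_def m_def mult_ac)
  finally have "second_order_linear 0 (\<lambda>t. ((\<Sum>S\<in>UNIV. F S * W S t) + (- c))\<^sup>2)"
    by (rule second_order_linear_square)
  then have f3: "second_order_concave (\<lambda>t. \<kappa> * ((\<Sum>S\<in>UNIV. F S * W S t) + (- c))\<^sup>2)"
    by (intro second_order_concave_cmult second_order_linear_imp_concave \<open>\<kappa> \<ge> 0\<close>)
  have f: "second_order_concave f"
  proof -
    have "f = (\<lambda>t. (\<Sum>S\<in>UNIV. \<psi> S * W S t) + (\<Sum>S\<in>UNIV. \<Sum>T\<in>UNIV. l S T * half_harm (W S t) (W T t))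
        + \<kappa> * ((\<Sum>S\<in>UNIV. F S * W S t) + (- c))\<^sup>2)"
      by (rule ext) (simp add: f_def objective_def expect_def W_def mult.commute)
    with second_order_concave_add[OF second_order_concave_add[OF f1 f2] f3] show ?thesis by simp
  qed
  have "m\<^sup>2 \<le> real CARD('n) * (u \<bullet> u)"
  proof -
    have n: "norm (vtx S) = sqrt (real CARD('n))" for S :: "'n set"
      by (simp add: norm_eq_sqrt_inner inner_vtx_self)
    have "\<bar>m\<bar> \<le> (\<Sum>S\<in>UNIV. \<bar>wt A h S * (u \<bullet> vtx S)\<bar>)"
      unfolding m_def expect_def by (rule sum_abs)
    also have "\<dots> \<le> (\<Sum>S\<in>UNIV. wt A h S * (norm u * sqrt (real CARD('n))))"
    proof (intro sum_mono)
      fix S :: "'n set"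
      have "\<bar>u \<bullet> vtx S\<bar> \<le> norm u * sqrt (real CARD('n))"
        using Cauchy_Schwarz_ineq2[of u "vtx S"] n by simp
      then show "\<bar>wt A h S * (u \<bullet> vtx S)\<bar> \<le> wt A h S * (norm u * sqrt (real CARD('n)))"
        using wt_pos[of A h S] by (simp add: abs_mult)
    qed
    also have "\<dots> = norm u * sqrt (real CARD('n))"
      by (simp add: sum_wt flip: sum_distrib_right)
    finally have "\<bar>m\<bar>\<^sup>2 \<le> (norm u * sqrt (real CARD('n)))\<^sup>2" by (intro power_mono) auto
    then show ?thesis by (simp add: power_mult_distrib power2_norm_eq_inner mult.commute)
  qed
  from lyapunov_strictly_decreasing[OF this \<open>u \<noteq> 0\<close>, of A h]
  obtain d where "d > 0" and d: "\<forall>\<^sub>F t in at 0. lyapunov (A' t) (h' t) + lyapunov (A' (- t)) (h' (- t)) - 2 * lyapunov A h \<le> - d * t\<^sup>2"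
    by (auto simp: A'_def h'_def)
  \<comment> \<open>Half of the strict decrease \<open>\<beta> d t^2\<close> is spent on absorbing
    the \<open>o(t^2)\<close> error of \<open>f\<close>.\<close>
  have "\<beta> * d / 2 > 0" using \<open>\<beta> > 0\<close> \<open>d > 0\<close> by simp
  then have ev: "\<forall>\<^sub>F t in at 0. f t + f (- t) - 2 * f 0 \<le> \<beta> * d / 2 * t\<^sup>2"
    using f unfolding second_order_concave_def by blast
  have ev1: "\<forall>\<^sub>F t in at (0::real). t \<noteq> 0" by (simp add: eventually_at_filter)
  have ev2: "\<forall>\<^sub>F t in at (0::real). t\<^sup>2 < \<epsilon>"
  proof -
    have "((\<lambda>t. t\<^sup>2) \<longlongrightarrow> 0\<^sup>2) (at (0::real))" by (intro tendsto_intros)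
    then show ?thesis by (rule order_tendstoD) (use \<open>\<epsilon> > 0\<close> in simp)
  qed
  obtain t where t: "f t + f (- t) - 2 * f 0 \<le> \<beta> * d / 2 * t\<^sup>2" "t \<noteq> 0" "t\<^sup>2 < \<epsilon>"
      "lyapunov (A' t) (h' t) + lyapunov (A' (- t)) (h' (- t)) - 2 * lyapunov A h \<le> - d * t\<^sup>2"
    using eventually_happens'[OF at_neq_bot, OF eventually_conj[OF d eventually_conj[OF ev eventually_conj[OF ev1 ev2]]]]
    by blast
  have "\<beta> * (lyapunov (A' t) (h' t) + lyapunov (A' (- t)) (h' (- t)) - 2 * lyapunov A h) \<le> \<beta> * (- d * t\<^sup>2)"
    using t(4) \<open>\<beta> > 0\<close> by (intro mult_left_mono) auto
  moreover have "\<beta> * d * t\<^sup>2 > 0" using \<open>\<beta> > 0\<close> \<open>d > 0\<close> t(2) by simp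
  ultimately have "(f t + \<beta> * lyapunov (A' t) (h' t)) + (f (- t) + \<beta> * lyapunov (A' (- t)) (h' (- t)))
      < 2 * (f 0 + \<beta> * lyapunov A h)"
    using t(1) by (simp add: algebra_simps)
  moreover have "a < c \<or> b < c" if "a + b < 2 * c" for a b c :: real using that by linarith
  ultimately have "f t + \<beta> * lyapunov (A' t) (h' t) < f 0 + \<beta> * lyapunov A h
      \<or> f (- t) + \<beta> * lyapunov (A' (- t)) (h' (- t)) < f 0 + \<beta> * lyapunov A h" by blast
  then obtain r where "f r + \<beta> * lyapunov (A' r) (h' r) < f 0 + \<beta> * lyapunov A h" "r\<^sup>2 < \<epsilon>"
    using t(3) by (metis power2_minus)
  then show ?thesis
    unfolding f_def A'0 h'0 by (intro exI[of _ r] exI[of _ "h' r"]) (simp add: A'_def)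
qed

lemma below_minus_outer:
  assumes A: "A \<in> psd_below J" and c: "c * (y \<bullet> (A *v y)) \<le> 1" "c \<ge> 0"
  shows "A - c *\<^sub>R outer (A *v y) \<in> psd_below J"
proof -
  define B where "B = A - c *\<^sub>R outer (A *v y)"
  have sym: "transpose A = A" and psd: "\<And>x. 0 \<le> x \<bullet> (A *v x)" and le: "\<And>x. x \<bullet> (A *v x) \<le> x \<bullet> (J *v x)"
    using A by (auto simp: psd_below_def)
  have "x \<bullet> (B *v x) = x \<bullet> (A *v x) - c * ((A *v y) \<bullet> x)\<^sup>2" for x
    by (simp add: B_def matrix_vector_mult_diff_rdistrib scaleR_matrix_vector_assoc[symmetric] outer_mult
        inner_diff_right power2_eq_square inner_commute[of x "A *v y"])
  moreover have "0 \<le> c * ((A *v y) \<bullet> x)\<^sup>2" for x using c by simp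
  moreover have "transpose B = B"
    using sym transpose_outer[of "A *v y"] by (simp add: B_def transpose_def vec_eq_iff)
  ultimately have "B \<in> psd_below J"
    using psd_minus_outer[OF sym psd c] le unfolding psd_below_def by simp (smt (verit))
  then show ?thesis by (simp add: B_def)
qed

lemma half_harm_nonneg: "p \<ge> 0 \<Longrightarrow> q \<ge> 0 \<Longrightarrow> half_harm p q \<ge> 0"
  by (simp add: half_harm_def)

lemma continuous_on_half_harm [continuous_intros]:
  assumes "continuous_on X f" "continuous_on X g" "\<And>z. z \<in> X \<Longrightarrow> f z > 0" "\<And>z. z \<in> X \<Longrightarrow> g z > 0"
  shows "continuous_on X (\<lambda>z. half_harm (f z) (g z))"
  unfolding half_harm_def using assms(3,4)
  by (intro continuous_intros assms) (metis add_pos_pos less_irrefl)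

lemma continuous_on_lyap [continuous_intros]:
  assumes "continuous_on X f" "continuous_on X g"
  shows "continuous_on X (\<lambda>z. lyapunov (f z) (g z))"
  unfolding lyapunov_def trace_def by (intro continuous_intros assms)

lemma trace_nonneg:
  fixes A :: "real ^ 'n ^ 'n"
  assumes "\<And>x. 0 \<le> x \<bullet> (A *v x)"
  shows "trace A \<ge> 0"
proof -
  have "A $ i $ i = axis i 1 \<bullet> (A *v axis i 1)" for i
    by (simp add: inner_axis' matrix_vector_mult_basis column_def)
  then show ?thesis unfolding trace_def using assms by (simp add: sum_nonneg)
qed

text \<open>A minimiser over all \<open>(A, v)\<close> with \<open>0 \<le> A \<le> J\<close> exists
  by coercivity in \<open>v\<close>, and it does at least as well as \<open>(J, h)\<close>. A range
  of dimension two or more would contain a nonzero direction uncorrelated with \<open>F\<close>,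
  along which the value could still be lowered.\<close>

lemma rank_one_minimiser:
  fixes J :: "real ^ 'n ^ 'n" and h :: "real ^ 'n"
  assumes J: "J \<in> psd_below J" and l: "\<And>S T. l S T \<ge> 0" and "\<kappa> \<ge> 0" "\<beta> > 0"
  shows "\<exists>u v. outer u \<in> psd_below J \<and>
    objective \<psi> l \<kappa> F c (outer u) v + \<beta> * lyapunov (outer u) v \<le> objective \<psi> l \<kappa> F c J h + \<beta> * lyapunov J h"
proof -
  define \<Phi> where "\<Phi> z = objective \<psi> l \<kappa> F c (fst z) (snd z) + \<beta> * lyapunov (fst z) (snd z)" for z
  define M where "M = (\<Sum>S\<in>UNIV. \<bar>\<psi> S\<bar>)"
  \<comment> \<open>All terms but the linear one are nonnegative, and that one is at least
    \<open>-M\<close>; so \<open>v \<bullet> v \<le> R\<close> wherever \<open>\<Phi>\<close> does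
    not exceed its value at \<open>(J, h)\<close>.\<close>
  define R where "R = (\<Phi> (J, h) + M) / \<beta>"
  have lower: "\<beta> * (v \<bullet> v) \<le> \<Phi> (A, v) + M" if "A \<in> psd_below J" for A v
  proof -
    have "- M \<le> (\<Sum>S\<in>UNIV. \<psi> S * wt A v S)"
      unfolding M_def sum_negf[symmetric]
    proof (intro sum_mono)
      fix S
      have "\<bar>\<psi> S * wt A v S\<bar> \<le> \<bar>\<psi> S\<bar> * 1"
        unfolding abs_mult using wt_pos[of A v S] wt_le_1[of A v S] by (intro mult_left_mono) auto
      then show "- \<bar>\<psi> S\<bar> \<le> \<psi> S * wt A v S" by simp
    qed
    moreover have "0 \<le> (\<Sum>S\<in>UNIV. \<Sum>T\<in>UNIV. l S T * half_harm (wt A v S) (wt A v T))"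
      by (intro sum_nonneg mult_nonneg_nonneg l half_harm_nonneg less_imp_le wt_pos)
    moreover have "0 \<le> \<kappa> * (expect A v F - c)\<^sup>2" using \<open>\<kappa> \<ge> 0\<close> by simp
    moreover have "v \<bullet> v \<le> lyapunov A v"
    proof -
      have "trace A \<ge> 0" using that by (intro trace_nonneg) (auto simp: psd_below_def)
      then have "1 \<le> exp ((real CARD('n) + 3) * trace A)" by simp
      then have "(1 + v \<bullet> v) * 1 \<le> lyapunov A v" unfolding lyapunov_def by (intro mult_left_mono) auto
      then show ?thesis by simp
    qed
    then have "\<beta> * (v \<bullet> v) \<le> \<beta> * lyapunov A v" using \<open>\<beta> > 0\<close> by simp
    ultimately show ?thesis by (simp add: \<Phi>_def objective_def)
  qed
  define K where "K = psd_below J \<times> {v::real^'n. v \<bullet> v \<le> R}"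
  have "compact {v::real^'n. v \<bullet> v \<le> R}"
  proof -
    have "closed {v::real^'n. v \<bullet> v \<le> R}" by (intro closed_Collect_le continuous_intros)
    moreover have "bounded {v::real^'n. v \<bullet> v \<le> R}"
      by (rule boundedI[of _ "sqrt R"]) (simp add: norm_eq_sqrt_inner)
    ultimately show ?thesis by (simp add: compact_eq_bounded_closed)
  qed
  then have "compact K" unfolding K_def by (intro compact_Times compact_below)
  have inK: "(A, v) \<in> K" if "A \<in> psd_below J" "\<Phi> (A, v) \<le> \<Phi> (J, h)" for A v
    using lower[OF that(1), of v] that \<open>\<beta> > 0\<close> by (simp add: K_def R_def pos_le_divide_eq mult.commute)
  have "(J, h) \<in> K" using J by (intro inK) auto
  moreover have "continuous_on K \<Phi>"
    unfolding \<Phi>_def objective_def expect_def by (intro continuous_intros wt_pos)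
  ultimately obtain z where z: "z \<in> K" "\<And>z'. z' \<in> K \<Longrightarrow> \<Phi> z \<le> \<Phi> z'"
    using continuous_attains_inf[OF \<open>compact K\<close>] by blast
  obtain A v where Av: "z = (A, v)" by (cases z)
  have A: "A \<in> psd_below J" using z(1) Av by (simp add: K_def)
  have le: "\<Phi> (A, v) \<le> \<Phi> (J, h)" using z(2)[OF \<open>(J, h) \<in> K\<close>] by (simp add: Av)
  \<comment> \<open>Outside \<open>K\<close> the value is larger than at \<open>(J, h)\<close>, so
    the minimum over \<open>K\<close> is global.\<close>
  have min: "\<Phi> (A, v) \<le> \<Phi> (B, v')" if "B \<in> psd_below J" for B v'
    using z(2)[of "(B, v')"] inK[OF that, of v'] le unfolding Av by fastforce
  \<comment> \<open>The covariance of \<open>F\<close> with the point \<open>x\<close> under the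
    minimising measure; a direction is uncorrelated with \<open>F\<close> exactly when it is
    orthogonal to \<open>b\<close>.\<close>
  define b where "b = (\<Sum>S\<in>UNIV. (wt A v S * F S) *\<^sub>R (vtx S - (\<Sum>T\<in>UNIV. wt A v T *\<^sub>R vtx T)))"
  have "\<exists>u. A = outer u"
  proof (rule psd_eq_outer)
    show "transpose A = A" "\<And>x. 0 \<le> x \<bullet> (A *v x)" using A by (auto simp: psd_below_def)
    fix y assume b: "b \<bullet> (A *v y) = 0"
    show "A *v y = 0"
    proof (rule ccontr)
      assume "A *v y \<noteq> 0"
      have "(\<Sum>S\<in>UNIV. wt A v S * F S * ((A *v y) \<bullet> vtx S - expect A v (\<lambda>S. (A *v y) \<bullet> vtx S))) = (A *v y) \<bullet> b"
        by (simp add: b_def expect_def inner_sum_right inner_diff_right)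
      then have cov: "(\<Sum>S\<in>UNIV. wt A v S * F S * ((A *v y) \<bullet> vtx S - expect A v (\<lambda>S. (A *v y) \<bullet> vtx S))) = 0"
        using b by (simp add: inner_commute)
      \<comment> \<open>The step must satisfy \<open>t^2 p \<le> 1\<close>; using
        \<open>p + 1\<close> avoids dividing by zero.\<close>
      define p where "p = y \<bullet> (A *v y)"
      have "p \<ge> 0" using A by (simp add: p_def psd_below_def)
      have "1 / (p + 1) > 0" using \<open>p \<ge> 0\<close> by simp
      from objective_improvement[where l = l and \<psi> = \<psi> and c = c, OF l \<open>\<kappa> \<ge> 0\<close> \<open>\<beta> > 0\<close> cov \<open>A *v y \<noteq> 0\<close> this]
      obtain t v' where t: "t\<^sup>2 < 1 / (p + 1)" "\<Phi> (A - t\<^sup>2 *\<^sub>R outer (A *v y), v') < \<Phi> (A, v)"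
        unfolding \<Phi>_def by auto
      have "t\<^sup>2 * (p + 1) < 1" using t(1) \<open>p \<ge> 0\<close> by (simp add: field_simps)
      then have "t\<^sup>2 * p \<le> 1" by (simp add: distrib_left) (smt (verit) zero_le_power2)
      then have "A - t\<^sup>2 *\<^sub>R outer (A *v y) \<in> psd_below J"
        by (intro below_minus_outer A) (auto simp: p_def)
      from min[OF this, of v'] t(2) show False by simp
    qed
  qed
  then obtain u where "A = outer u" ..
  then show ?thesis using A le by (auto simp: \<Phi>_def)
qed

section \<open>The decomposition\<close>

lemma finite_borel_measure:
  fixes q :: "'a::{second_countable_topology, t1_space} \<Rightarrow> real"
  assumes T: "finite T" "\<And>x. x \<in> T \<Longrightarrow> 0 \<le> q x" "(\<Sum>x\<in>T. q x) = 1"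
  shows "\<exists>m. prob_space m \<and> sets m = sets borel \<and> (AE x in m. x \<in> T)
    \<and> (\<forall>f\<in>borel_measurable borel. (\<integral>x. f x \<partial>m) = (\<Sum>x\<in>T. q x * f x :: real))"
proof -
  define P where "P = point_measure T (\<lambda>x. ennreal (q x))"
  define m where "m = distr P borel (\<lambda>x. x)"
  have meas: "(\<lambda>x. x) \<in> measurable P borel" by (simp add: P_def measurable_point_measure_eq1)
  interpret P: prob_space P
    unfolding P_def using T by (intro prob_space_point_measure) (auto simp: sum_ennreal)
  have "prob_space m" unfolding m_def by (rule P.prob_space_distr[OF meas])
  moreover have "sets m = sets borel" by (simp add: m_def)
  moreover have "AE x in m. x \<in> T"
  proof -
    have "T \<in> sets borel" using T(1) by (simp add: finite_imp_closed)
    then show ?thesis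
      unfolding m_def using meas by (subst AE_distr_iff) (auto simp: P_def space_point_measure intro!: AE_I2)
  qed
  moreover have "(\<integral>x. f x \<partial>m) = (\<Sum>x\<in>T. q x * f x)" if "f \<in> borel_measurable borel" for f :: "'a \<Rightarrow> real"
    unfolding m_def by (subst integral_distr[OF meas that])
      (simp add: P_def lebesgue_integral_point_measure_finite[OF T(1,2)])
  ultimately show ?thesis by blast
qed

lemma sum_UNIV_sum_type:
  fixes f :: "'a::finite + 'b::finite \<Rightarrow> 'c::comm_monoid_add"
  shows "(\<Sum>k\<in>UNIV. f k) = (\<Sum>a\<in>UNIV. f (Inl a)) + (\<Sum>b\<in>UNIV. f (Inr b))"
  by (simp add: sum.Plus flip: UNIV_Plus_UNIV)

text \<open>The moment alternative with reference value \<open>lyapunov J h\<close>; its dual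
  hypothesis is \<open>rank_one_minimiser\<close>. Asking for a mean squared deviation
  \<open>\<le> 0\<close> encodes that the mean of \<open>F\<close> is constant on the
  mixture.\<close>

lemma rank_one_decomposition:
  fixes J :: "real ^ 'n ^ 'n" and h :: "real ^ 'n" and F :: "'n set \<Rightarrow> real"
  assumes "sym_pos_def J"
  shows "\<exists>T q. finite T \<and> (\<forall>z\<in>T. 0 \<le> q z) \<and> (\<Sum>z\<in>T. q z) = (1::real)
    \<and> (\<forall>S. (\<Sum>z\<in>T. q z * wt (outer (fst z)) (snd z) S) = wt J h S)
    \<and> (\<forall>S S'. (\<Sum>z\<in>T. q z * half_harm (wt (outer (fst z)) (snd z) S) (wt (outer (fst z)) (snd z) S'))
        \<le> half_harm (wt J h S) (wt J h S'))
    \<and> (\<Sum>z\<in>T. q z * (expect (outer (fst z)) (snd z) F - expect J h F)\<^sup>2) \<le> 0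
    \<and> (\<forall>z\<in>T. (norm (fst z))\<^sup>2 \<le> onorm ((*v) J))"
proof -
  have J: "J \<in> psd_below J" using assms unfolding sym_pos_def_def psd_below_def
    by (auto intro: less_imp_le) (metis inner_zero_left less_imp_le order_refl)
  \<comment> \<open>Only the norm bound implied by \<open>outer u \<in> psd_below J\<close> is kept;
    it is closed and bounds \<open>u\<close>, leaving the control of \<open>v\<close> to
    \<open>\<Lambda>\<close>.\<close>
  define \<Theta> where "\<Theta> = {(u::real^'n, v::real^'n). (norm u)\<^sup>2 \<le> onorm ((*v) J)}"
  define c where "c = expect J h F"
  \<comment> \<open>Every component is centred so that the parameter \<open>(J, h)\<close> would
    give \<open>0\<close>; the components under \<open>Inl\<close> are the equality
    constraints.\<close>
  define f :: "(real^'n) \<times> (real^'n) \<Rightarrow> real ^ ('n set + (('n set \<times> 'n set) + unit))" where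
    "f z = (\<chi> k. case k of
        Inl S \<Rightarrow> wt (outer (fst z)) (snd z) S - wt J h S
      | Inr (Inl (S, T)) \<Rightarrow> half_harm (wt (outer (fst z)) (snd z) S) (wt (outer (fst z)) (snd z) T)
            - half_harm (wt J h S) (wt J h T)
      | Inr (Inr _) \<Rightarrow> (expect (outer (fst z)) (snd z) F - c)\<^sup>2)" for z
  define \<Lambda> where "\<Lambda> z = lyapunov (outer (fst z)) (snd z)" for z :: "(real^'n) \<times> (real^'n)"
  have lyap_ge: "lyapunov A v \<ge> 1 + v \<bullet> v" if "trace A \<ge> 0" for A :: "real^'n^'n" and v
  proof -
    have "(1 + v \<bullet> v) * 1 \<le> lyapunov A v" unfolding lyapunov_def using that by (intro mult_left_mono) auto
    then show ?thesis by simp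
  qed
  have \<Lambda>: "\<Lambda> z \<ge> 1 + snd z \<bullet> snd z" for z
    unfolding \<Lambda>_def by (rule lyap_ge) (simp add: trace_outer)
  have hh: "0 \<le> half_harm (wt A v S) (wt A v T) \<and> half_harm (wt A v S) (wt A v T) \<le> 1"
    for A :: "real^'n^'n" and v S T
  proof -
    have "wt A v S * wt A v T \<le> wt A v S * 1"
      using wt_pos[of A v S] wt_le_1[of A v T] by (intro mult_left_mono) auto
    also have "\<dots> \<le> wt A v S + wt A v T" using wt_pos[of A v T] by simp
    finally show ?thesis
      using wt_pos[of A v S] wt_pos[of A v T] by (simp add: half_harm_def)
  qed
  define G where "G = (\<Sum>S\<in>UNIV. \<bar>F S\<bar>)"
  have expF: "\<bar>expect A v F\<bar> \<le> G" for A :: "real^'n^'n" and v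
  proof -
    have "\<bar>expect A v F\<bar> \<le> (\<Sum>S\<in>UNIV. \<bar>wt A v S * F S\<bar>)" unfolding expect_def by (rule sum_abs)
    also have "\<dots> \<le> (\<Sum>S\<in>UNIV. 1 * \<bar>F S\<bar>)"
      unfolding abs_mult using wt_pos[of A v] wt_le_1[of A v]
      by (intro sum_mono mult_right_mono) (auto simp: abs_of_pos)
    finally show ?thesis by (simp add: G_def)
  qed
  define N where "N = (\<Sum>k\<in>(UNIV :: ('n set + (('n set \<times> 'n set) + unit)) set). 1 + (2 * G)\<^sup>2)"
  have f_le: "norm (f z) \<le> N" for z
  proof -
    have "\<bar>f z $ k\<bar> \<le> 1 + (2 * G)\<^sup>2" for k
    proof (cases k)
      case (Inl S)
      have "\<bar>f z $ k\<bar> \<le> 1"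
        using wt_pos[of "outer (fst z)" "snd z" S] wt_le_1[of "outer (fst z)" "snd z" S]
          wt_pos[of J h S] wt_le_1[of J h S] unfolding f_def Inl by simp
      then show ?thesis using zero_le_power2[of "2 * G"] by linarith
    next
      case (Inr k')
      show ?thesis
      proof (cases k')
        case (Inl p)
        obtain S T where p: "p = (S, T)" by (cases p)
        have "\<bar>f z $ k\<bar> \<le> 1"
          using hh[of "outer (fst z)" "snd z" S T] hh[of J h S T] unfolding f_def Inl Inr p by (auto simp: abs_le_iff)
        then show ?thesis using zero_le_power2[of "2 * G"] by linarith
      next
        case k': (Inr i)
        have "\<bar>expect (outer (fst z)) (snd z) F - c\<bar> \<le> 2 * G"
          using expF[of "outer (fst z)" "snd z"] expF[of J h] by (simp add: c_def)
        then have "\<bar>expect (outer (fst z)) (snd z) F - c\<bar>\<^sup>2 \<le> (2 * G)\<^sup>2" by (intro power_mono) auto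
        then show ?thesis unfolding f_def Inr k' by simp
      qed
    qed
    then show ?thesis
      unfolding N_def by (intro order_trans[OF norm_le_l1_cart] sum_mono)
  qed
  have "\<exists>T q. finite T \<and> T \<subseteq> \<Theta> \<and> (\<forall>z\<in>T. 0 \<le> q z) \<and> (\<Sum>z\<in>T. q z) = (1::real)
      \<and> (\<forall>k\<in>range Inl. (\<Sum>z\<in>T. q z * f z $ k) = 0) \<and> (\<forall>k. (\<Sum>z\<in>T. q z * f z $ k) \<le> 0)"
  proof (rule finite_moment_alternative[of \<Theta> f \<Lambda> N "lyapunov J h"])
    show "closed \<Theta>"
      unfolding \<Theta>_def case_prod_beta by (intro closed_Collect_le continuous_intros)
    show "continuous_on \<Theta> f"
      unfolding f_def
    proof (rule continuous_on_vec_lambda)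
      fix k :: "'n set + (('n set \<times> 'n set) + unit)"
      show "continuous_on \<Theta> (\<lambda>z. case k of
        Inl S \<Rightarrow> wt (outer (fst z)) (snd z) S - wt J h S
      | Inr (Inl (S, T)) \<Rightarrow> half_harm (wt (outer (fst z)) (snd z) S) (wt (outer (fst z)) (snd z) T)
            - half_harm (wt J h S) (wt J h T)
      | Inr (Inr _) \<Rightarrow> (expect (outer (fst z)) (snd z) F - c)\<^sup>2)"
      proof (cases k)
        case (Inr k')
        then show ?thesis
          by (cases k') (auto simp: expect_def split: prod.split intro!: continuous_intros wt_pos)
      qed (auto intro!: continuous_intros)
    qed
    show "continuous_on \<Theta> \<Lambda>" unfolding \<Lambda>_def by (intro continuous_intros)
    show "\<Lambda> z \<ge> 1" for z using \<Lambda>[of z] inner_ge_zero[of "snd z"] by linarith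
    show "norm (f z) \<le> N" for z by (rule f_le)
    show "bounded {z \<in> \<Theta>. \<Lambda> z \<le> R}" for R
    proof (rule bounded_subset)
      show "bounded (cball (0::real^'n) (sqrt (onorm ((*v) J))) \<times> cball (0::real^'n) (sqrt R))"
        by (intro bounded_Times bounded_cball)
      show "{z \<in> \<Theta>. \<Lambda> z \<le> R} \<subseteq> cball 0 (sqrt (onorm ((*v) J))) \<times> cball 0 (sqrt R)"
      proof
        fix z assume z: "z \<in> {z \<in> \<Theta>. \<Lambda> z \<le> R}"
        have "(norm (snd z))\<^sup>2 \<le> R"
          using z \<Lambda>[of z] by (simp add: power2_norm_eq_inner)
        moreover have "(norm (fst z))\<^sup>2 \<le> onorm ((*v) J)" using z by (auto simp: \<Theta>_def)
        ultimately show "z \<in> cball 0 (sqrt (onorm ((*v) J))) \<times> cball 0 (sqrt R)"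
          by (auto simp: mem_Times_iff real_le_rsqrt)
      qed
    qed
    have "trace J \<ge> 0" using J by (intro trace_nonneg) (auto simp: psd_below_def)
    then show "lyapunov J h > 0" using lyap_ge[of J h] inner_ge_zero[of h] by linarith
    fix a0 \<beta> :: real and a :: "real ^ ('n set + (('n set \<times> 'n set) + unit))"
    assume a: "\<And>k. k \<notin> range Inl \<Longrightarrow> a $ k \<ge> 0" "\<beta> > 0" "a0 + \<beta> * lyapunov J h < 0"
    define \<psi> where "\<psi> S = a $ Inl S" for S
    define l where "l S T = a $ Inr (Inl (S, T))" for S T
    define \<kappa> where "\<kappa> = a $ Inr (Inr ())"
    have "l S T \<ge> 0" for S T unfolding l_def by (intro a) auto
    moreover have "\<kappa> \<ge> 0" unfolding \<kappa>_def by (intro a) auto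
    ultimately obtain u v where uv: "outer u \<in> psd_below J"
      "objective \<psi> l \<kappa> F c (outer u) v + \<beta> * lyapunov (outer u) v \<le> objective \<psi> l \<kappa> F c J h + \<beta> * lyapunov J h"
      using rank_one_minimiser[OF J _ _ \<open>\<beta> > 0\<close>] by blast
    have "a \<bullet> f (u, v) = objective \<psi> l \<kappa> F c (outer u) v - objective \<psi> l \<kappa> F c J h"
    proof -
      have "a \<bullet> f (u, v) = (\<Sum>S\<in>UNIV. \<psi> S * (wt (outer u) v S - wt J h S))
        + ((\<Sum>p\<in>UNIV. l (fst p) (snd p) * (half_harm (wt (outer u) v (fst p)) (wt (outer u) v (snd p))
            - half_harm (wt J h (fst p)) (wt J h (snd p))))
        + \<kappa> * (expect (outer u) v F - c)\<^sup>2)"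
        by (simp add: inner_vec_def f_def sum_UNIV_sum_type \<psi>_def l_def \<kappa>_def UNIV_unit case_prod_beta)
      also have "(\<Sum>p\<in>UNIV. l (fst p) (snd p) * (half_harm (wt (outer u) v (fst p)) (wt (outer u) v (snd p))
            - half_harm (wt J h (fst p)) (wt J h (snd p))))
        = (\<Sum>S\<in>UNIV. \<Sum>T\<in>UNIV. l S T * (half_harm (wt (outer u) v S) (wt (outer u) v T)
            - half_harm (wt J h S) (wt J h T)))"
        by (simp add: sum.cartesian_product case_prod_beta)
      finally show ?thesis
        by (simp add: objective_def right_diff_distrib sum_subtractf c_def)
    qed
    \<comment> \<open>By minimality the left side is at most
      \<open>a0 + \<beta> * lyapunov J h\<close>, which is negative.\<close>
    then have "a0 + a \<bullet> f (u, v) + \<beta> * \<Lambda> (u, v) \<le> 0"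
      using uv(2) a(3) by (simp add: \<Lambda>_def)
    moreover have "(u, v) \<in> \<Theta>" using norm_outer_in_below[OF uv(1)] by (simp add: \<Theta>_def)
    ultimately show "\<exists>z\<in>\<Theta>. a0 + a \<bullet> f z + \<beta> * \<Lambda> z \<le> 0" by blast
  qed
  then obtain T q where T: "finite T" "T \<subseteq> \<Theta>" "\<And>z. z \<in> T \<Longrightarrow> 0 \<le> q z" "(\<Sum>z\<in>T. q z) = (1::real)"
    and eq: "\<And>S. (\<Sum>z\<in>T. q z * f z $ Inl S) = 0" and le: "\<And>k. (\<Sum>z\<in>T. q z * f z $ k) \<le> 0"
    by auto
  have shift: "(\<Sum>z\<in>T. q z * (g z - d)) = (\<Sum>z\<in>T. q z * g z) - d" for g d
    by (simp add: right_diff_distrib sum_subtractf T(4) flip: sum_distrib_right)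
  have "(\<Sum>z\<in>T. q z * wt (outer (fst z)) (snd z) S) = wt J h S" for S
    using eq[of S] by (simp add: f_def shift)
  moreover have "(\<Sum>z\<in>T. q z * half_harm (wt (outer (fst z)) (snd z) S) (wt (outer (fst z)) (snd z) S'))
      \<le> half_harm (wt J h S) (wt J h S')" for S S'
    using le[of "Inr (Inl (S, S'))"] by (simp add: f_def shift)
  moreover have "(\<Sum>z\<in>T. q z * (expect (outer (fst z)) (snd z) F - expect J h F)\<^sup>2) \<le> 0"
    using le[of "Inr (Inr ())"] by (simp add: f_def c_def)
  moreover have "\<forall>z\<in>T. (norm (fst z))\<^sup>2 \<le> onorm ((*v) J)" using T(2) by (auto simp: \<Theta>_def)
  ultimately show ?thesis
    using T(1,3,4) by (intro exI[of _ T] exI[of _ q]) auto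
qed

theorem theorem12:
  fixes J :: "real ^ 'n ^ 'n" and h :: "real ^ 'n" and \<phi> :: "real ^ 'n \<Rightarrow> real"
  assumes "sym_pos_def J"
  shows "\<exists>m :: ((real ^ 'n) \<times> (real ^ 'n)) measure.
    prob_space m \<and> sets m = sets borel \<and>
    (\<forall>A \<subseteq> cube. measure (ising_measure J h) A
        = (\<integral>(u, v). measure (rank_one_measure u v) A \<partial>m)) \<and>
    (AE (u, v) in m. (\<integral>x. \<phi> x \<partial>rank_one_measure u v) = (\<integral>x. \<phi> x \<partial>ising_measure J h)) \<and>
    (AE (u, v) in m. (norm u)\<^sup>2 \<le> onorm ((*v) J)) \<and>
    (\<forall>x \<in> cube. \<forall>y \<in> cube. neighbours x y \<longrightarrow>
      (\<integral>(u, v). measure (rank_one_measure u v) {x} * measure (rank_one_measure u v) {y}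
          / (measure (rank_one_measure u v) {x} + measure (rank_one_measure u v) {y}) \<partial>m)
      \<le> measure (ising_measure J h) {x} * measure (ising_measure J h) {y}
          / (measure (ising_measure J h) {x} + measure (ising_measure J h) {y}))"
proof -
  define F where "F S = \<phi> (vtx S)" for S :: "'n set"
  obtain T0 q where T0: "finite T0" "\<forall>z\<in>T0. 0 \<le> q z" "(\<Sum>z\<in>T0. q z) = (1::real)"
    and bary0: "\<forall>S. (\<Sum>z\<in>T0. q z * wt (outer (fst z)) (snd z) S) = wt J h S"
    and harm0: "\<forall>S S'. (\<Sum>z\<in>T0. q z * half_harm (wt (outer (fst z)) (snd z) S) (wt (outer (fst z)) (snd z) S'))
        \<le> half_harm (wt J h S) (wt J h S')"
    and dev0: "(\<Sum>z\<in>T0. q z * (expect (outer (fst z)) (snd z) F - expect J h F)\<^sup>2) \<le> 0"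
    and onorm0: "\<forall>z\<in>T0. (norm (fst z))\<^sup>2 \<le> onorm ((*v) J)"
    using rank_one_decomposition[OF assms, of h F] by - (elim exE conjE, rule that)
  \<comment> \<open>Points of weight zero carry no information on the mean of \<open>F\<close>, so
    they are removed before the measure is built.\<close>
  define T where "T = {z \<in> T0. q z > 0}"
  have to_T: "(\<Sum>z\<in>T. q z * g z) = (\<Sum>z\<in>T0. q z * g z)" for g :: "_ \<Rightarrow> real"
    unfolding T_def using T0(1,2) by (intro sum.mono_neutral_left) (auto simp: order_less_le)
  have "(\<Sum>z\<in>T. q z) = 1" using to_T[of "\<lambda>_. 1"] T0(3) by simp
  moreover have "finite T" using T0(1) by (simp add: T_def)
  moreover have "0 \<le> q z" if "z \<in> T" for z using that by (simp add: T_def)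
  ultimately obtain m where m: "prob_space m" "sets m = sets borel" and AE_m: "AE z in m. z \<in> T"
    and int_m: "\<And>g. g \<in> borel_measurable borel \<Longrightarrow> (\<integral>z. g z \<partial>m) = (\<Sum>z\<in>T0. q z * g z :: real)"
    using finite_borel_measure[of T q] unfolding to_T by blast
  have meas_wt: "(\<lambda>z. wt (outer (fst z)) (snd z) S) \<in> borel_measurable borel" for S :: "'n set"
    by (intro borel_measurable_continuous_onI continuous_intros)
  have meas_harm: "(\<lambda>z. half_harm (wt (outer (fst z)) (snd z) S) (wt (outer (fst z)) (snd z) S')) \<in> borel_measurable borel"
    for S S' :: "'n set"
    by (intro borel_measurable_continuous_onI continuous_intros wt_pos)
  have "measure (ising_measure J h) A = (\<integral>(u, v). measure (rank_one_measure u v) A \<partial>m)" if "A \<subseteq> cube" for A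
  proof -
    have "(\<integral>(u, v). measure (rank_one_measure u v) A \<partial>m)
        = (\<integral>z. (\<Sum>S | vtx S \<in> A. wt (outer (fst z)) (snd z) S) \<partial>m)"
      unfolding rank_one_measure_eq_ising_measure measure_ising_measure[OF that] case_prod_beta ..
    also have "\<dots> = (\<Sum>z\<in>T0. q z * (\<Sum>S | vtx S \<in> A. wt (outer (fst z)) (snd z) S))"
      by (intro int_m borel_measurable_sum meas_wt)
    also have "\<dots> = (\<Sum>S | vtx S \<in> A. \<Sum>z\<in>T0. q z * wt (outer (fst z)) (snd z) S)"
      unfolding sum_distrib_left by (rule sum.swap)
    finally show ?thesis by (simp add: bary0 measure_ising_measure[OF that])
  qed
  moreover have "AE (u, v) in m. (\<integral>x. \<phi> x \<partial>rank_one_measure u v) = (\<integral>x. \<phi> x \<partial>ising_measure J h)"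
  proof -
    have "expect (outer (fst z)) (snd z) F = expect J h F" if "z \<in> T" for z
    proof -
      have nonneg: "0 \<le> q z * (expect (outer (fst z)) (snd z) F - expect J h F)\<^sup>2" if "z \<in> T0" for z
        using T0(2) that by simp
      \<comment> \<open>A sum of nonnegative terms that is \<open>\<le> 0\<close> vanishes term by
        term, so the deviation is zero wherever the weight is positive.\<close>
      then have "(\<Sum>z\<in>T0. q z * (expect (outer (fst z)) (snd z) F - expect J h F)\<^sup>2) = 0"
        using dev0 by (intro antisym sum_nonneg)
      then have "q z * (expect (outer (fst z)) (snd z) F - expect J h F)\<^sup>2 = 0"
        using that nonneg T0(1) by (auto simp: sum_nonneg_eq_0_iff T_def)
      then show ?thesis using that by (simp add: T_def)
    qed
    then have "AE z in m. expect (outer (fst z)) (snd z) F = expect J h F"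
      using AE_m by (auto elim: AE_mp)
    then show ?thesis
      by (simp add: rank_one_measure_eq_ising_measure integral_ising_measure expect_def F_def case_prod_beta)
  qed
  moreover have "AE (u, v) in m. (norm u)\<^sup>2 \<le> onorm ((*v) J)"
    using AE_m onorm0 unfolding case_prod_beta by (auto simp: T_def elim!: AE_mp)
  moreover have "(\<integral>(u, v). measure (rank_one_measure u v) {x} * measure (rank_one_measure u v) {y}
          / (measure (rank_one_measure u v) {x} + measure (rank_one_measure u v) {y}) \<partial>m)
      \<le> measure (ising_measure J h) {x} * measure (ising_measure J h) {y}
          / (measure (ising_measure J h) {x} + measure (ising_measure J h) {y})"
    if xy: "x \<in> cube" "y \<in> cube" for x y
  proof -
    obtain S S' where S: "x = vtx S" "y = vtx S'" using xy by (auto simp flip: range_vtx)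
    show ?thesis
      using spec[OF spec[OF harm0], of S S'] int_m[OF meas_harm[of S S']]
      unfolding S rank_one_measure_eq_ising_measure measure_ising_measure_vtx case_prod_beta
      unfolding half_harm_def by simp
  qed
  ultimately show ?thesis using m by (intro exI[of _ m]) blast
qed

end
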